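(* Let $k$ be an algebraically closed field, $H$ a $k$-vector space of finite dimension $d$, $P^\bullet$ and $Q^\bullet$ complete flags in $H$, and $a_\bullet,b_\bullet\in\mathbb{Z}^{r+1}$ sequences with $0\le a_0<\dots<a_r<d$ and $0\le b_0<\dots<b_r<d$. Let $\rho=1+(r+1)(d-r-1)-\sum_{i=0}^r(a_i-i)-\sum_{i=0}^r(b_i-i)$. Let $\Lambda\in\Sigma^\circ_{P^\bullet,a_\bullet}\cap\Sigma^\circ_{Q^\bullet,b_\bullet}$ be a $k$-point, and suppose $P^\bullet$ and $Q^\bullet$ are almost-transverse, with $t+t'=d$ such that $\dim P^t\cap Q^{t'}=1$. Suppose first that $t=a_i$ for some $i$ active in $a_\bullet$, that $t'=b_{i'}$ for some $i'$ active in $b_\bullet$, and that $$P^t\cap Q^{t'}\subseteq\Lambda\subseteq P^t+Q^{t'}.$$ Then $$\dim T_\Lambda\bigl(\Sigma_{P^\bullet,a_\bullet}\cap\Sigma_{Q^\bullet,b_\bullet}\bigr)=\rho.$$ If those conditions do not all hold, then $$\dim T_\Lambda\bigl(\Sigma_{P^\bullet,a_\bullet}\cap\Sigma_{Q^\bullet,b_\bullet}\bigr)=\rho-1.$$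
   Context: Complete flags are indexed by codimension: $0=P^d\subset\dots\subset P^1\subset P^0=H$ with $\operatorname{codim}P^i=i$. Two complete flags $P^\bullet,Q^\bullet$ in $H$ are almost-transverse if there exists an index $t\in\{1,\dots,d-1\}$ such that $\dim P^i\cap Q^{d-i}$ equals $0$ if $i\ne t$ and equals $1$ if $i=t$. The Schubert variety $\Sigma_{P^\bullet,a_\bullet}$ is the closed subscheme of $\operatorname{Gr}(r+1,H)$ (the Grassmannian of $(r+1)$-dimensional subspaces) defined by the determinantal conditions $\dim(\Lambda\cap P^{a_i})\ge r+1-i$ for $i=0,\dots,r$ (i.e. $\Lambda\to H/P^{a_i}$ has rank at most $i$). The intersection $\Sigma_{P^\bullet,a_\bullet}\cap\Sigma_{Q^\bullet,b_\bullet}$ is scheme-theoretic, and $T_\Lambda$ denotes its Zariski tangent space. An index $i\in\{0,\dots,r\}$ is active in $a_\bullet$ if $i>0$ and $a_i>a_{i-1}+1$, or $i=0$ and $a_0>0$. $\Sigma^\circ_{P^\bullet,a_\bullet}$ is the open subscheme of $\Sigma_{P^\bullet,a_\bullet}$ of those $\Lambda$ with $\dim(\Lambda\cap P^{a_i})=r+1-i$ for every active index $i$ in $a_\bullet$. The same definitions apply to $(Q^\bullet,b_\bullet)$. *)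

theory Defs
  imports
    "HOL-Library.Poly_Mapping"
    "HOL-Library.Function_Algebras"
    "HOL-Computational_Algebra.Polynomial"
    "Jordan_Normal_Form.Determinant"
begin

section \<open>Flags and Schubert conditions\<close>

text \<open>The ambient space \<open>H\<close> is the whole type \<open>'v\<close>, with scalar multiplication \<open>scale\<close>.
  Flags are indexed by codimension; only the values \<open>P 0, \<dots>, P d\<close> matter.\<close>

definition complete_flag ::
  "('k::field \<Rightarrow> 'v::ab_group_add \<Rightarrow> 'v) \<Rightarrow> (nat \<Rightarrow> 'v set) \<Rightarrow> bool" where
  "complete_flag scale P \<longleftrightarrow>
     (let d = vector_space.dim scale UNIV in
       (\<forall>i\<le>d. module.subspace scale (P i) \<and> vector_space.dim scale (P i) = d - i) \<and>
       (\<forall>i<d. P (Suc i) \<subseteq> P i))"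

definition almost_transverse ::
  "('k::field \<Rightarrow> 'v::ab_group_add \<Rightarrow> 'v) \<Rightarrow> (nat \<Rightarrow> 'v set) \<Rightarrow> (nat \<Rightarrow> 'v set) \<Rightarrow> bool" where
  "almost_transverse scale P Q \<longleftrightarrow>
     (let d = vector_space.dim scale UNIV in
       \<exists>t. 1 \<le> t \<and> t \<le> d - 1 \<and>
         (\<forall>i\<le>d. vector_space.dim scale (P i \<inter> Q (d - i)) = (if i = t then 1 else 0)))"

definition active :: "nat \<Rightarrow> (nat \<Rightarrow> nat) \<Rightarrow> nat \<Rightarrow> bool" where
  "active r a i \<longleftrightarrow> i \<le> r \<and> ((i > 0 \<and> a i > a (i - 1) + 1) \<or> (i = 0 \<and> a 0 > 0))"

text \<open>On the level of \<open>k\<close>-points only; the scheme structure is given by ideals below.\<close>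

definition grassmannian ::
  "('k::field \<Rightarrow> 'v::ab_group_add \<Rightarrow> 'v) \<Rightarrow> nat \<Rightarrow> 'v set set" where
  "grassmannian scale n = {L. module.subspace scale L \<and> vector_space.dim scale L = n}"

definition schubert_points ::
  "('k::field \<Rightarrow> 'v::ab_group_add \<Rightarrow> 'v) \<Rightarrow> nat \<Rightarrow> (nat \<Rightarrow> 'v set) \<Rightarrow> (nat \<Rightarrow> nat) \<Rightarrow> 'v set set" where
  "schubert_points scale r P a =
     {L \<in> grassmannian scale (r + 1). \<forall>i\<le>r. vector_space.dim scale (L \<inter> P (a i)) \<ge> r + 1 - i}"

definition schubert_open_points ::
  "('k::field \<Rightarrow> 'v::ab_group_add \<Rightarrow> 'v) \<Rightarrow> nat \<Rightarrow> (nat \<Rightarrow> 'v set) \<Rightarrow> (nat \<Rightarrow> nat) \<Rightarrow> 'v set set" where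
  "schubert_open_points scale r P a =
     {L \<in> schubert_points scale r P a.
        \<forall>i. active r a i \<longrightarrow> vector_space.dim scale (L \<inter> P (a i)) = r + 1 - i}"


section \<open>Closed subschemes of affine space and the Zariski tangent space at the origin\<close>

text \<open>Polynomials with coefficients in \<open>'k\<close>, in variables indexed by \<open>'x\<close>. The coordinate ring
  of the affine space with (finite) coordinate set \<open>V\<close> is the subring \<open>polys V\<close>; a closed
  subscheme of this affine space is an ideal of \<open>polys V\<close>.\<close>

type_synonym ('x, 'k) mpol = "('x \<Rightarrow>\<^sub>0 nat) \<Rightarrow>\<^sub>0 'k"

definition pconst :: "'k::comm_ring_1 \<Rightarrow> ('x, 'k) mpol" where
  "pconst c = Poly_Mapping.single 0 c"

definition pvar :: "'x \<Rightarrow> ('x, 'k::comm_ring_1) mpol" where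
  "pvar x = Poly_Mapping.single (Poly_Mapping.single x 1) 1"

definition polys :: "'x set \<Rightarrow> ('x, 'k::comm_ring_1) mpol set" where
  "polys V = {f. \<forall>m \<in> Poly_Mapping.keys f. Poly_Mapping.keys m \<subseteq> V}"

definition ideal_generated ::
  "'x set \<Rightarrow> ('x, 'k::comm_ring_1) mpol set \<Rightarrow> ('x, 'k) mpol set" where
  "ideal_generated V G =
     {\<Sum>g\<in>F. h g * g | F h. finite F \<and> F \<subseteq> G \<and> (\<forall>g\<in>F. h g \<in> polys V)}"

definition origin_ideal :: "'x set \<Rightarrow> ('x, 'k::comm_ring_1) mpol set" where
  "origin_ideal V = {f \<in> polys V. Poly_Mapping.lookup f 0 = 0}"

text \<open>For an ideal \<open>I\<close> of \<open>R = polys V\<close> contained in the maximal ideal \<open>M = origin_ideal V\<close>,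
  the local ring of \<open>Spec (R / I)\<close> at the origin, with maximal ideal \<open>m\<close>, has
  \<open>m / m\<^sup>2 = M / (M\<^sup>2 + I)\<close>. The Zariski tangent space \<open>(m / m\<^sup>2)\<^sup>*\<close> thus consists of the linear
  functionals on \<open>M\<close> that vanish on \<open>M\<^sup>2\<close> and on \<open>I\<close>. In order to represent each of them by a
  unique HOL function they are extended by \<open>0\<close> outside \<open>M\<close>.\<close>

definition zariski_tangent_space ::
  "'x set \<Rightarrow> ('x, 'k::comm_ring_1) mpol set \<Rightarrow> (('x, 'k) mpol \<Rightarrow> 'k) set" where
  "zariski_tangent_space V I = (let M = origin_ideal V in
     {l. (\<forall>f\<in>M. \<forall>g\<in>M. l (f + g) = l f + l g) \<and>
         (\<forall>c. \<forall>f\<in>M. l (pconst c * f) = c * l f) \<and>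
         (\<forall>f\<in>M. \<forall>g\<in>M. l (f * g) = 0) \<and>
         (\<forall>f\<in>I. l f = 0) \<and>
         (\<forall>f. f \<notin> M \<longrightarrow> l f = 0)})"

definition tangent_dim :: "'x set \<Rightarrow> ('x, 'k::field) mpol set \<Rightarrow> nat" where
  "tangent_dim V I = vector_space.dim (\<lambda>c l f. c * l f) (zariski_tangent_space V I)"


section \<open>Schubert schemes in the affine charts of the Grassmannian\<close>

text \<open>An adapted frame for \<open>L\<close> is a basis \<open>e 0, \<dots>, e (d - 1)\<close> of \<open>H\<close> whose first \<open>r + 1\<close> vectors
  form a basis of \<open>L\<close>. It determines the affine open neighbourhood of \<open>L\<close> in the Grassmannian
  consisting of the complements of \<open>C = \<langle>e (r + 1), \<dots>, e (d - 1)\<rangle>\<close>. Such a complement has a unique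
  basis of the form \<open>e j + (\<Sum>l = r + 1..<d. x\<^bsub>l j\<^esub> e l)\<close> for \<open>j = 0, \<dots>, r\<close>, so that the
  neighbourhood is the affine space with coordinates \<open>x\<^bsub>l j\<^esub>\<close>, and \<open>L\<close> is its origin.\<close>

definition adapted_frame ::
  "('k::field \<Rightarrow> 'v::ab_group_add \<Rightarrow> 'v) \<Rightarrow> nat \<Rightarrow> 'v set \<Rightarrow> (nat \<Rightarrow> 'v) \<Rightarrow> bool" where
  "adapted_frame scale r L e \<longleftrightarrow>
     (let d = vector_space.dim scale UNIV in
       inj_on e {..<d} \<and> \<not> module.dependent scale (e ` {..<d}) \<and>
       module.span scale (e ` {..<d}) = UNIV \<and> module.span scale (e ` {..r}) = L)"

definition chart_vars :: "nat \<Rightarrow> nat \<Rightarrow> (nat \<times> nat) set" where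
  "chart_vars d r = {r + 1..<d} \<times> {..r}"

text \<open>The value of the functional \<open>\<phi>\<close> on the \<open>j\<close>-th basis vector of the universal subspace.\<close>

definition chart_entry ::
  "nat \<Rightarrow> nat \<Rightarrow> (nat \<Rightarrow> 'v) \<Rightarrow> ('v \<Rightarrow> 'k::comm_ring_1) \<Rightarrow> nat \<Rightarrow> (nat \<times> nat, 'k) mpol" where
  "chart_entry d r e \<phi> j = pconst (\<phi> (e j)) + (\<Sum>l = r + 1..<d. pconst (\<phi> (e l)) * pvar (l, j))"

definition annihilator ::
  "('k::field \<Rightarrow> 'v::ab_group_add \<Rightarrow> 'v) \<Rightarrow> 'v set \<Rightarrow> ('v \<Rightarrow> 'k) set" where
  "annihilator scale S = {\<phi>. Vector_Spaces.linear scale (*) \<phi> \<and> (\<forall>x\<in>S. \<phi> x = 0)}"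

text \<open>The minors of size \<open>n\<close> of the map from the universal subspace to \<open>H / S\<close>. The linear
  functionals on \<open>H / S\<close> are those on \<open>H\<close> that annihilate \<open>S\<close>; allowing arbitrary functionals
  for the rows rather than the coordinates with respect to a basis of \<open>H / S\<close> only adds linear
  combinations of minors and hence gives the same ideal.\<close>

definition chart_minors ::
  "('k::field \<Rightarrow> 'v::ab_group_add \<Rightarrow> 'v) \<Rightarrow> nat \<Rightarrow> (nat \<Rightarrow> 'v) \<Rightarrow> 'v set \<Rightarrow> nat \<Rightarrow>
     (nat \<times> nat, 'k) mpol set" where
  "chart_minors scale r e S n =
     {det (mat n n (\<lambda>(p, q). chart_entry (vector_space.dim scale UNIV) r e (\<phi> p) (c q))) | \<phi> c.
        (\<forall>p<n. \<phi> p \<in> annihilator scale S) \<and> (\<forall>q<n. c q \<le> r)}"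

text \<open>The ideal of the Schubert scheme: the universal subspace \<open>\<rightarrow> H / P (a i)\<close> has rank at
  most \<open>i\<close> for all \<open>i \<le> r\<close>.\<close>

definition schubert_ideal ::
  "('k::field \<Rightarrow> 'v::ab_group_add \<Rightarrow> 'v) \<Rightarrow> nat \<Rightarrow> (nat \<Rightarrow> 'v) \<Rightarrow> (nat \<Rightarrow> 'v set) \<Rightarrow> (nat \<Rightarrow> nat) \<Rightarrow>
     (nat \<times> nat, 'k) mpol set" where
  "schubert_ideal scale r e P a =
     ideal_generated (chart_vars (vector_space.dim scale UNIV) r)
       (\<Union>i\<le>r. chart_minors scale r e (P (a i)) (i + 1))"

text \<open>The dimension of the Zariski tangent space at \<open>L\<close> of the scheme-theoretic intersection of
  two Schubert schemes, whose ideal is the sum of their ideals, computed in the chart of a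
  frame \<open>e\<close> adapted to \<open>L\<close>.\<close>

definition schubert_intersection_tangent_dim ::
  "('k::field \<Rightarrow> 'v::ab_group_add \<Rightarrow> 'v) \<Rightarrow> nat \<Rightarrow> (nat \<Rightarrow> 'v) \<Rightarrow> (nat \<Rightarrow> 'v set) \<Rightarrow> (nat \<Rightarrow> nat) \<Rightarrow>
     (nat \<Rightarrow> 'v set) \<Rightarrow> (nat \<Rightarrow> nat) \<Rightarrow> nat" where
  "schubert_intersection_tangent_dim scale r e P a Q b =
     tangent_dim (chart_vars (vector_space.dim scale UNIV) r)
       {f + g | f g. f \<in> schubert_ideal scale r e P a \<and> g \<in> schubert_ideal scale r e Q b}"

lemma vector_space_functionals: "vector_space (\<lambda>(c::'k::field) (l::'b \<Rightarrow> 'k) f. c * l f)"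
  by unfold_locales (auto simp: algebra_simps)

lemma subspace_zariski_tangent_space:
  "module.subspace (\<lambda>(c::'k::field) l f. c * l f)
     (zariski_tangent_space V (I :: ('x, 'k) mpol set))"
proof -
  interpret vector_space "\<lambda>(c::'k) (l::('x, 'k) mpol \<Rightarrow> 'k) f. c * l f"
    by (rule vector_space_functionals)
  show ?thesis
    by (rule subspaceI) (auto simp: zariski_tangent_space_def Let_def algebra_simps)
qed

lemma adapted_frame_exists:
  assumes "finite_dimensional_vector_space scale Basis" and "L \<in> grassmannian scale (r + 1)"
  shows "\<exists>e. adapted_frame scale r L e"
proof -
  interpret finite_dimensional_vector_space scale Basis by fact
  have L: "subspace L" "dim L = r + 1" using assms(2) by (auto simp: grassmannian_def)
  obtain B where B: "B \<subseteq> L" "independent B" "L \<subseteq> span B" "card B = r + 1"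
    using basis_exists[of L] L by metis
  define B' where "B' = extend_basis B"
  have B': "B \<subseteq> B'" "independent B'" "span B' = UNIV"
    using B(2) by (auto simp: B'_def extend_basis_superset independent_extend_basis)
  have fin: "finite B" "finite B'"
    using B(2) B'(2) independent_bound_general finiteI_independent by blast+
  have card: "card B' = dim UNIV" using dim_eq_card[of B' UNIV] B' by simp
  obtain f where f: "bij_betw f {..<r + 1} B"
    using ex_bij_betw_nat_finite[OF fin(1)] B(4) by (auto simp: atLeast0LessThan)
  have "card (B' - B) = dim UNIV - (r + 1)"
    using card B(4) fin B'(1) by (simp add: card_Diff_subset)
  then obtain g where g: "bij_betw g {r + 1..<dim UNIV} (B' - B)"
    using finite_same_card_bij[of "{r + 1..<dim UNIV}" "B' - B"] fin by auto
  define e where "e j = (if j < r + 1 then f j else g j)" for j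
  have le: "r + 1 \<le> dim UNIV" using card_mono[OF fin(2) B'(1)] card B(4) by simp
  have e1: "bij_betw e {..<r + 1} B"
    using f by (rule bij_betw_cong[THEN iffD1, rotated]) (auto simp: e_def)
  have e2: "bij_betw e {r + 1..<dim UNIV} (B' - B)"
    using g by (rule bij_betw_cong[THEN iffD1, rotated]) (auto simp: e_def)
  have "bij_betw e ({..<r + 1} \<union> {r + 1..<dim UNIV}) (B \<union> (B' - B))"
    using e1 e2 by (rule bij_betw_combine) auto
  moreover have "{..<r + 1} \<union> {r + 1..<dim UNIV} = {..<dim UNIV}" using le by auto
  moreover have "B \<union> (B' - B) = B'" using B'(1) by auto
  ultimately have e: "bij_betw e {..<dim UNIV} B'" by simp
  have "e ` {..r} = B" using e1 by (simp add: bij_betw_def lessThan_Suc_atMost)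
  moreover have "span B = L" using B L(1) by (metis span_minimal subset_antisym)
  ultimately show ?thesis
    using e B' by (auto simp: adapted_frame_def bij_betw_def Let_def)
qed

end

theory Submission
  imports Defs
begin

text \<open>The tangent space of a Schubert variety at a point \<open>L\<close> of its open stratum consists of the
  \<open>x \<in> Hom(L, H / L)\<close> that map \<open>L \<inter> P (a i)\<close> into \<open>(P (a i) + L) / L\<close> for all active \<open>i\<close>; the
  inactive conditions are already implied, because passing from \<open>P (a i)\<close> to a subspace of
  codimension \<open>m\<close> in it raises the rank by at most \<open>m\<close>. Under the trace pairing it is the
  orthogonal complement of the space of those \<open>y \<in> Hom(H / L, L)\<close> that are sums of rank-one maps
  \<open>h \<mapsto> \<phi> h *s v\<close> with \<open>v \<in> L \<inter> P (a i)\<close> and \<open>\<phi>\<close> vanishing on \<open>L + P (a i)\<close>. This conormal space has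
  dimension \<open>\<Sum>i\<le>r. a i - i\<close>, so that it only remains to intersect the two conormal spaces.
  An element of both, viewed as an endomorphism of \<open>H\<close>, maps \<open>P c\<close> into \<open>P (c + 1)\<close> and \<open>Q c\<close> into
  \<open>Q (c + 1)\<close> for all \<open>c\<close>. For almost-transverse flags this forces it to vanish on \<open>P t + Q t'\<close>
  and to take values in the line \<open>P t \<inter> Q t'\<close>. The maps of this kind form a line, which lies in
  both conormal spaces if the special conditions hold and meets their intersection in \<open>0\<close>
  otherwise.\<close>

section \<open>Vector spaces\<close>

text \<open>The number \<open>\<rho> - 1\<close> is dim Hom(L, H / L) minus the two codimensions, so
  the tangent space has the expected dimension exactly when the two conormal spaces meet in 0. For
  transverse flags an endomorphism that is strict on both flags is 0: P c is P (c + 1) plus the line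
  P c \<inter> Q (d - c - 1), which is mapped into P (c + 1) \<inter> Q (d - c) = 0. For
  almost-transverse flags this descent from P d = 0 still reaches P t and breaks only at c = t - 1,
  where P t \<inter> Q (d - t) is no longer 0. The same argument for Q yields the hyperplane P t + Q
  (d - t) on which the map vanishes. The other obstacle is that the scheme is given by minors, and
  ranks are of little use for matrices over the dual numbers k[eps]. Rank at most i is therefore
  replaced by a factorization through a free module of rank i, which makes all minors of size i + 1
  vanish. Conversely, well-chosen minors recover the linear condition at an active index; this uses
  that L \<inter> P (a i) has dimension exactly r + 1 - i there.\<close>

context vector_space
begin

lemma independent_Un:
  assumes "independent S" "independent T" "finite S" "finite T" "span S \<inter> span T \<subseteq> {0}"
  shows "independent (S \<union> T)" and "S \<inter> T = {}"
proof -
  show disj: "S \<inter> T = {}"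
    using assms(1,2,5) span_base dependent_zero by blast
  show "independent (S \<union> T)"
  proof (rule independent_if_scalars_zero)
    show "finite (S \<union> T)" using assms by simp
    fix f x assume sum: "(\<Sum>x\<in>S \<union> T. f x *s x) = 0" and x: "x \<in> S \<union> T"
    let ?s = "\<Sum>x\<in>S. f x *s x" and ?t = "\<Sum>x\<in>T. f x *s x"
    have st: "?s + ?t = 0" using sum assms disj by (simp add: sum.union_disjoint)
    have "?s \<in> span S" "?t \<in> span T" by (auto intro: span_sum span_scale span_base)
    moreover have "?s = - ?t" using st by (simp add: eq_neg_iff_add_eq_0)
    ultimately have "?s \<in> span S \<inter> span T" by (auto intro: span_neg)
    then have "?s = 0" using assms(5) by auto
    then have "?s = 0" "?t = 0" using st by simp_all
    then show "f x = 0"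
      using x independentD[OF assms(1,3) order.refl] independentD[OF assms(2,4) order.refl] by blast
  qed
qed

lemma independent_Un_disjoint_span:
  assumes "independent (S \<union> T)" "finite S" "finite T" "S \<inter> T = {}"
  shows "span S \<inter> span T \<subseteq> {0}"
proof
  fix x assume "x \<in> span S \<inter> span T"
  then have "x \<in> span S" "x \<in> span T" by auto
  then obtain u w where u: "x = (\<Sum>v\<in>S. u v *s v)" and w: "x = (\<Sum>v\<in>T. w v *s v)"
    unfolding span_finite[OF assms(2)] span_finite[OF assms(3)] by (elim rangeE)
  let ?f = "\<lambda>v. if v \<in> S then u v else - w v"
  have "(\<Sum>v\<in>S \<union> T. ?f v *s v) = (\<Sum>v\<in>S. ?f v *s v) + (\<Sum>v\<in>T. ?f v *s v)"
    using assms by (simp add: sum.union_disjoint)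
  also have "(\<Sum>v\<in>S. ?f v *s v) = x" unfolding u by (rule sum.cong) auto
  also have "(\<Sum>v\<in>T. ?f v *s v) = (\<Sum>v\<in>T. - (w v *s v))"
    using assms(4) by (intro sum.cong) auto
  also have "\<dots> = - x" unfolding w by (simp add: sum_negf)
  finally have "(\<Sum>v\<in>S \<union> T. ?f v *s v) = 0" by simp
  then have "?f v = 0" if "v \<in> S" for v
    using independentD[OF assms(1) _ order.refl, of ?f v] assms that by blast
  then show "x \<in> {0}" unfolding u by (auto intro!: sum.neutral)
qed

text \<open>Meant for the space of functions on all index pairs, which is infinite-dimensional: only
  the two subspaces lie in finite spans. Bases \<open>D\<close> of \<open>A\<close> and
  \<open>E\<close> of \<open>B\<close> extend a basis \<open>C\<close> of the intersection, and
  \<open>D \<union> (E - C)\<close> is a basis of the sum.\<close>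

lemma dim_sums_Int_finite_span:
  assumes "subspace A" "subspace B" "A \<subseteq> span X" "B \<subseteq> span Y" "finite X" "finite Y"
  shows "dim {x + y | x y. x \<in> A \<and> y \<in> B} + dim (A \<inter> B) = dim A + dim B"
proof -
  obtain C where C: "C \<subseteq> A \<inter> B" "independent C" "A \<inter> B \<subseteq> span C"
    using maximal_independent_subset by blast
  obtain D where D: "C \<subseteq> D" "D \<subseteq> A" "independent D" "A \<subseteq> span D"
    using maximal_independent_subset_extend[of C A] C by blast
  obtain E where E: "C \<subseteq> E" "E \<subseteq> B" "independent E" "B \<subseteq> span E"
    using maximal_independent_subset_extend[of C B] C by blast
  have "D \<subseteq> span X" "E \<subseteq> span Y" using D(2) E(2) assms(3,4) by (meson order_trans)+
  then have fin: "finite D" "finite E"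
    using independent_span_bound[OF assms(5) D(3)] independent_span_bound[OF assms(6) E(3)] by simp_all
  then have finC: "finite C" using D(1) finite_subset by blast
  have sp: "span C = A \<inter> B" "span D = A" "span E = B"
    by (rule span_subspace[OF C(1,3) subspace_inter[OF assms(1,2)]]
        span_subspace[OF D(2,4) assms(1)] span_subspace[OF E(2,4) assms(2)])+
  have "span D \<inter> span (E - C) \<subseteq> span C \<inter> span (E - C)"
    using sp span_mono[of "E - C" E] by (simp add: subset_iff)
  also have "\<dots> \<subseteq> {0}"
    using independent_Un_disjoint_span[of C "E - C"] E(1,3) fin finC
    by (simp add: Un_absorb1)
  finally have dis: "span D \<inter> span (E - C) \<subseteq> {0}" .
  have ind: "independent (D \<union> (E - C))" and dj: "D \<inter> (E - C) = {}"
    using independent_Un[OF D(3) independent_mono[OF E(3)] fin(1) _ dis] fin by simp_all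
  have eq: "D \<union> (E - C) = D \<union> E" using D(1) by auto
  have "span (D \<union> E) = {x + y | x y. x \<in> A \<and> y \<in> B}"
    unfolding span_Un sp ..
  then have "dim {x + y | x y. x \<in> A \<and> y \<in> B} = card (D \<union> (E - C))"
    using dim_span_eq_card_independent[OF ind] eq by simp
  also have "\<dots> = card D + (card E - card C)"
    using dj fin finC E(1) by (simp add: card_Un_disjoint card_Diff_subset)
  finally show ?thesis
    using dim_eq_card_independent[OF C(2)] dim_eq_card_independent[OF D(3)]
      dim_eq_card_independent[OF E(3)] sp card_mono[OF fin(2) E(1)]
    by (simp flip: dim_span[of C] dim_span[of D] dim_span[of E])
qed

lemma linear_functional_iff:
  "Vector_Spaces.linear scale (*) \<phi> \<longleftrightarrow> (\<forall>x y. \<phi> (x + y) = \<phi> x + \<phi> y) \<and> (\<forall>c x. \<phi> (c *s x) = c * \<phi> x)"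
proof -
  have "vector_space ((*) :: 'a \<Rightarrow> 'a \<Rightarrow> 'a)" by unfold_locales (simp_all add: algebra_simps)
  then show ?thesis unfolding Vector_Spaces.linear_iff using vector_space_axioms by simp
qed

lemma linear_functional_sum:
  assumes "Vector_Spaces.linear scale (*) \<phi>"
  shows "\<phi> (\<Sum>i\<in>I. c i *s x i) = (\<Sum>i\<in>I. c i * \<phi> (x i))"
proof -
  have "\<phi> 0 = 0" using assms unfolding linear_functional_iff by (metis mult_zero_left scale_zero_left)
  then show ?thesis
    using assms by (induction I rule: infinite_finite_induct) (simp_all add: linear_functional_iff)
qed

lemma functional_extend:
  assumes "independent B"
  shows "\<exists>\<phi>. Vector_Spaces.linear scale (*) \<phi> \<and> (\<forall>x\<in>B. \<phi> x = f x)"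
proof -
  have "vector_space_pair scale ((*) :: 'a \<Rightarrow> 'a \<Rightarrow> 'a)"
    by unfold_locales (simp_all add: algebra_simps)
  from vector_space_pair.linear_independent_extend[OF this assms] show ?thesis by blast
qed

lemma functional_zero_on_span:
  assumes "Vector_Spaces.linear scale (*) \<phi>" "\<And>x. x \<in> B \<Longrightarrow> \<phi> x = 0" "x \<in> span B"
  shows "\<phi> x = 0"
proof -
  have "subspace {x. \<phi> x = 0}"
    using assms(1) unfolding linear_functional_iff
    by (intro subspaceI) (simp_all, metis mult_zero_left scale_zero_left)
  then show ?thesis using span_minimal[of B "{x. \<phi> x = 0}"] assms(2,3) by blast
qed

text \<open>Applying \<open>f j\<close> to a vanishing combination of the \<open>x i\<close>
  isolates its j-th coefficient. Used for the unit functions, for orthogonal complements and for the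
  conormal spaces.\<close>

lemma independent_if_dual:
  assumes "finite I" "\<And>i. i \<in> I \<Longrightarrow> Vector_Spaces.linear scale (*) (f i)"
    and "\<And>i j. i \<in> I \<Longrightarrow> j \<in> I \<Longrightarrow> f i (x j) = (if i = j then 1 else 0)"
  shows "inj_on x I" and "independent (x ` I)"
proof -
  show inj: "inj_on x I"
    using assms(3) by (intro inj_onI) (metis zero_neq_one)
  show "independent (x ` I)"
  proof (rule independent_if_scalars_zero)
    fix u v assume "(\<Sum>v\<in>x ` I. u v *s v) = 0" and v: "v \<in> x ` I"
    then have sum: "(\<Sum>i\<in>I. u (x i) *s x i) = 0" by (simp add: sum.reindex[OF inj])
    obtain j where j: "j \<in> I" "v = x j" using v by auto
    \<comment> \<open>The instance of \<open>linear_functional_sum\<close> over the empty index set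
      says that \<open>f j\<close> maps 0 to 0.\<close>
    have "0 = f j (\<Sum>i\<in>I. u (x i) *s x i)"
      using linear_functional_sum[OF assms(2)[OF j(1)], of "\<lambda>_. 0" "\<lambda>_. 0" "{}"] sum by simp
    also have "\<dots> = (\<Sum>i\<in>I. u (x i) * f j (x i))"
      by (rule linear_functional_sum[OF assms(2)[OF j(1)]])
    also have "\<dots> = (\<Sum>i\<in>I. if i = j then u (x i) else 0)"
      using assms(3)[OF j(1)] by (intro sum.cong) auto
    also have "\<dots> = u v" using j assms(1) by simp
    finally show "u v = 0" by simp
  qed (use assms(1) in simp)
qed

lemma separating_functionals:
  assumes "subspace W" "finite C" "independent C" "span C \<inter> W \<subseteq> {0}"
  shows "\<exists>\<phi>. Vector_Spaces.linear scale (*) \<phi> \<and> (\<forall>x\<in>W. \<phi> x = 0) \<and> (\<forall>x\<in>C. \<phi> x = f x)"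
proof -
  obtain B where B: "B \<subseteq> W" "independent B" "W \<subseteq> span B"
    using maximal_independent_subset by blast
  have spB: "span B = W" using B assms by (simp add: span_subspace)
  \<comment> \<open>\<open>B\<close> may be infinite, so \<open>independent_Un\<close> is applied
    only to the finite part of \<open>B\<close> that occurs in a given linear relation.\<close>
  have "independent (B \<union> C)"
  proof
    assume "dependent (B \<union> C)"
    then obtain S u where S: "finite S" "S \<subseteq> B \<union> C" "(\<Sum>v\<in>S. u v *s v) = 0" "\<exists>v\<in>S. u v \<noteq> 0"
      unfolding dependent_explicit by blast
    have fin: "finite (S \<inter> B)" using S by auto
    have *: "span (S \<inter> B) \<inter> span C \<subseteq> {0}"
      using span_mono[of "S \<inter> B" B] spB assms(4) by auto
    have "independent ((S \<inter> B) \<union> C)"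
      by (rule independent_Un(1)[OF _ assms(3) fin assms(2) *]) (rule independent_mono[OF B(2)], auto)
    moreover have "S \<subseteq> (S \<inter> B) \<union> C" using S by auto
    ultimately have "independent S" using independent_mono by blast
    then show False using independentD[OF _ S(1) order.refl S(3)] S(4) by blast
  qed
  from functional_extend[OF this, of "\<lambda>x. if x \<in> B then 0 else f x"]
  obtain \<phi> where \<phi>: "Vector_Spaces.linear scale (*) \<phi>" "\<And>x. x \<in> B \<union> C \<Longrightarrow> \<phi> x = (if x \<in> B then 0 else f x)"
    by blast
  have "B \<inter> C = {}"
  proof -
    have "x = 0" if "x \<in> B" "x \<in> C" for x using that assms(4) B(1) span_base[of x C] by auto
    then show ?thesis using dependent_zero assms(3) by blast
  qed
  moreover have "\<phi> x = 0" if "x \<in> W" for x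
    using functional_zero_on_span[OF \<phi>(1), of B] \<phi>(2) that spB by auto
  ultimately show ?thesis using \<phi> by (metis IntI UnI2 empty_iff)
qed

lemma separating_functional:
  assumes "subspace W" "u \<notin> W"
  shows "\<exists>\<phi>. Vector_Spaces.linear scale (*) \<phi> \<and> (\<forall>x\<in>W. \<phi> x = 0) \<and> \<phi> u = 1"
proof -
  have u: "u \<noteq> 0" using assms subspace_0 by auto
  have "span {u} \<inter> W \<subseteq> {0}"
  proof
    fix x assume "x \<in> span {u} \<inter> W"
    then obtain k where k: "x = k *s u" "x \<in> W" by (auto simp: span_singleton)
    have "k = 0"
    proof (rule ccontr)
      assume "k \<noteq> 0"
      then have "u = inverse k *s x" using k by simp
      then show False using assms subspace_scale k by metis
    qed
    then show "x \<in> {0}" using k by simp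
  qed
  from separating_functionals[OF assms(1) _ _ this, of "\<lambda>_. 1"] u show ?thesis by auto
qed

end

context finite_dimensional_vector_space
begin

lemma dual_basis:
  fixes n :: nat
  assumes "inj_on w {..<n}" "independent (w ` {..<n})" "span (w ` {..<n}) = UNIV"
  shows "\<exists>f. (\<forall>m<n. Vector_Spaces.linear scale (*) (f m)) \<and>
    (\<forall>m<n. \<forall>l<n. f m (w l) = (if m = l then 1 else 0)) \<and>
    (\<forall>h. (\<Sum>m<n. f m h *s w m) = h)"
proof (intro exI conjI allI impI)
  let ?f = "\<lambda>m h. representation (w ` {..<n}) h (w m)"
  show "Vector_Spaces.linear scale (*) (?f m)" for m
    unfolding linear_functional_iff
    using assms by (auto simp: representation_add representation_scale)
  show "?f m (w l) = (if m = l then 1 else 0)" if "m < n" "l < n" for m l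
    using assms that by (auto simp: representation_basis inj_on_def)
  show "(\<Sum>m<n. ?f m h *s w m) = h" for h
  proof -
    have "h \<in> span (w ` {..<n})" using assms(3) by simp
    moreover have "finite (w ` {..<n})" by simp
    ultimately have "(\<Sum>b\<in>w ` {..<n}. representation (w ` {..<n}) h b *s b) = h"
      by (intro sum_representation_eq[OF assms(2)] order.refl)
    then show ?thesis by (simp only: sum.reindex[OF assms(1)] o_def)
  qed
qed

text \<open>Bases are indexed by numbers so that an extension leaves an initial segment untouched.
  With \<open>A = {0}\<close> and \<open>m = 0\<close> this also produces an indexed basis from
  nothing.\<close>

lemma indexed_basis_extend:
  assumes "subspace B" "A \<subseteq> B" "span (v ` {..<m}) = A" "inj_on v {..<m}" "independent (v ` {..<m})"
  shows "\<exists>v'. (\<forall>i<m. v' i = v i) \<and> m \<le> dim B \<and> span (v' ` {..<dim B}) = B \<and>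
    inj_on v' {..<dim B} \<and> independent (v' ` {..<dim B})"
proof -
  let ?X = "v ` {..<m}"
  have X: "?X \<subseteq> B" using assms(2) span_superset[of ?X] unfolding assms(3) by (rule order.trans[rotated])
  obtain Y where Y: "?X \<subseteq> Y" "Y \<subseteq> B" "independent Y" "B \<subseteq> span Y"
    using maximal_independent_subset_extend[OF X assms(5)] by blast
  have finY: "finite Y" using Y finiteI_independent by blast
  have spY: "span Y = B" by (rule span_subspace[OF Y(2,4) assms(1)])
  have cY: "card Y = dim B" by (rule basis_card_eq_dim[OF Y(2,4,3)])
  have cX: "card ?X = m" using assms(4) by (simp add: card_image)
  have le: "m \<le> dim B" using card_mono[OF finY Y(1)] cX cY by simp
  have "card (Y - ?X) = dim B - m" using cX cY Y(1) by (subst card_Diff_subset) simp_all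
  then obtain g where g: "bij_betw g {m..<dim B} (Y - ?X)"
    using finite_same_card_bij[of "{m..<dim B}" "Y - ?X"] finY by auto
  define v' where "v' i = (if i < m then v i else g i)" for i
  have "bij_betw v' {..<m} ?X"
    using assms(4) by (auto simp: bij_betw_def v'_def inj_on_def)
  moreover have "bij_betw v' {m..<dim B} (Y - ?X)"
    using g by (rule bij_betw_cong[THEN iffD1, rotated]) (auto simp: v'_def)
  ultimately have "bij_betw v' ({..<m} \<union> {m..<dim B}) (?X \<union> (Y - ?X))"
    by (rule bij_betw_combine) auto
  moreover have "{..<m} \<union> {m..<dim B} = {..<dim B}" "?X \<union> (Y - ?X) = Y" using le Y(1) by auto
  ultimately have "bij_betw v' {..<dim B} Y" by simp
  then show ?thesis using le spY Y(3)
    by (intro exI[of _ v']) (auto simp: v'_def bij_betw_def)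
qed

text \<open>Each step only appends vectors, so the initial segments that span the earlier members
  stay as they are, and one indexed basis serves the whole chain.\<close>

lemma adapted_basis_chain:
  fixes S :: "nat \<Rightarrow> 'b set"
  assumes "\<And>k. subspace (S k)" "mono S"
  shows "\<exists>v. inj_on v {..<dim (S n)} \<and> independent (v ` {..<dim (S n)}) \<and>
    (\<forall>k\<le>n. span (v ` {..<dim (S k)}) = S k)"
proof (induction n)
  case 0
  show ?case
    using indexed_basis_extend[of "S 0" "{0}" "\<lambda>_. 0" 0] assms(1) subspace_0[OF assms(1)]
      independent_empty by auto
next
  case (Suc n)
  then obtain v where v: "inj_on v {..<dim (S n)}" "independent (v ` {..<dim (S n)})"
    "\<And>k. k \<le> n \<Longrightarrow> span (v ` {..<dim (S k)}) = S k" by blast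
  have "S n \<subseteq> S (Suc n)" using assms(2) by (auto simp: mono_def)
  from indexed_basis_extend[OF assms(1) this v(3)[OF order.refl] v(1,2)]
  obtain v' where v': "\<And>i. i < dim (S n) \<Longrightarrow> v' i = v i" "span (v' ` {..<dim (S (Suc n))}) = S (Suc n)"
    "inj_on v' {..<dim (S (Suc n))}" "independent (v' ` {..<dim (S (Suc n))})" by blast
  have "span (v' ` {..<dim (S k)}) = S k" if "k \<le> Suc n" for k
  proof (cases "k = Suc n")
    case False
    then have k: "k \<le> n" using that by simp
    then have "dim (S k) \<le> dim (S n)" using assms(2) by (auto simp: mono_def intro: dim_subset)
    then have "v' ` {..<dim (S k)} = v ` {..<dim (S k)}" using v'(1) by (intro image_cong) auto
    then show ?thesis using v(3)[OF k] by simp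
  qed (use v' in simp)
  then show ?case using v' by blast
qed

end

section \<open>Orthogonality in function spaces\<close>

text \<open>Written out exactly as the scalar multiplication in \<open>tangent_dim\<close>, so that
  \<open>fun_space.dim\<close> is the dimension used there.\<close>

abbreviation (input) fscale :: "'k::field \<Rightarrow> ('z \<Rightarrow> 'k) \<Rightarrow> 'z \<Rightarrow> 'k" where
  "fscale \<equiv> \<lambda>c l z. c * l z"

interpretation fun_space: vector_space fscale
  by (rule vector_space_functionals)

text \<open>On the chart coordinates this is the trace pairing: \<open>x (l, j)\<close> is the
  \<open>e l\<close>-coefficient of the image of \<open>e j\<close> under a map L \<rightarrow> H /
  L, and \<open>y (l, j)\<close> the \<open>e j\<close>-coefficient of the image of
  \<open>e l\<close> under a map H / L \<rightarrow> L.\<close>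

definition pairing :: "'z set \<Rightarrow> ('z \<Rightarrow> 'k::field) \<Rightarrow> ('z \<Rightarrow> 'k) \<Rightarrow> 'k" where
  "pairing V x y = (\<Sum>z\<in>V. x z * y z)"

definition supported :: "'z set \<Rightarrow> ('z \<Rightarrow> 'k::zero) set" where
  "supported V = {x. \<forall>z. z \<notin> V \<longrightarrow> x z = 0}"

definition unit_fun :: "'z \<Rightarrow> 'z \<Rightarrow> 'k::field" where
  "unit_fun a z = (if z = a then 1 else 0)"

lemma subspace_supported: "fun_space.subspace (supported V)"
  by (rule fun_space.subspaceI) (auto simp: supported_def)

lemma sum_fun_apply: "(\<Sum>i\<in>I. (f i :: 'z \<Rightarrow> 'k::comm_monoid_add)) z = (\<Sum>i\<in>I. f i z)"
  by (induction I rule: infinite_finite_induct) auto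

lemma pairing_commute: "pairing V x y = pairing V y x"
  by (simp add: pairing_def mult.commute)

lemma linear_pairing: "Vector_Spaces.linear fscale (*) (pairing V x)"
  unfolding fun_space.linear_functional_iff pairing_def
  by (auto simp: sum.distrib sum_distrib_left algebra_simps)

lemma linear_pairing_left: "Vector_Spaces.linear fscale (*) (\<lambda>x. pairing V x y)"
  using linear_pairing[of V y] unfolding fun_space.linear_functional_iff
  by (simp add: pairing_commute[of V _ y])

lemma pairing_unit_fun: "finite V \<Longrightarrow> z \<in> V \<Longrightarrow> pairing V x (unit_fun z) = x z"
  by (simp add: pairing_def unit_fun_def if_distrib cong: if_cong)

lemma supported_expand:
  assumes "finite V" "x \<in> supported V"
  shows "x = (\<Sum>z\<in>V. fscale (x z) (unit_fun z))"
proof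
  fix z
  have "(\<Sum>a\<in>V. fscale (x a) (unit_fun a)) z = (\<Sum>a\<in>V. if z = a then x a else 0)"
    unfolding sum_fun_apply by (rule sum.cong) (simp_all add: unit_fun_def)
  also have "\<dots> = x z" using assms by (simp add: supported_def)
  finally show "x z = (\<Sum>a\<in>V. fscale (x a) (unit_fun a)) z" ..
qed

lemma unit_funs:
  assumes "finite V"
  shows "inj_on (unit_fun :: 'z \<Rightarrow> 'z \<Rightarrow> 'k::field) V"
    and "fun_space.independent (unit_fun ` V :: ('z \<Rightarrow> 'k) set)"
    and "fun_space.span (unit_fun ` V) = (supported V :: ('z \<Rightarrow> 'k) set)"
proof -
  have dual: "pairing V (unit_fun i) (unit_fun j) = (if i = j then 1 else (0::'k))" if "j \<in> V" for i j
    using assms that by (simp add: pairing_unit_fun) (simp add: unit_fun_def)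
  show "inj_on (unit_fun :: 'z \<Rightarrow> 'z \<Rightarrow> 'k) V" "fun_space.independent (unit_fun ` V :: ('z \<Rightarrow> 'k) set)"
    by (rule fun_space.independent_if_dual[OF assms linear_pairing dual], assumption)+
  have "(unit_fun ` V :: ('z \<Rightarrow> 'k) set) \<subseteq> supported V"
    by (auto simp: unit_fun_def supported_def)
  moreover have "supported V \<subseteq> fun_space.span (unit_fun ` V :: ('z \<Rightarrow> 'k) set)"
  proof
    fix x :: "'z \<Rightarrow> 'k" assume "x \<in> supported V"
    then show "x \<in> fun_space.span (unit_fun ` V)"
      by (subst supported_expand[OF assms])
        (auto intro: fun_space.span_sum fun_space.span_scale fun_space.span_base)
  qed
  ultimately show "fun_space.span (unit_fun ` V) = (supported V :: ('z \<Rightarrow> 'k) set)"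
    by (rule fun_space.span_subspace[OF _ _ subspace_supported])
qed

text \<open>A basis \<open>E\<close> of \<open>U\<close> is extended to a basis \<open>E'\<close> of
  all functions supported on \<open>V\<close>. The vectors that represent the dual functionals of
  the added elements \<open>E' - E\<close> form a basis of the orthogonal complement.\<close>

lemma dim_orthogonal:
  fixes U :: "('z \<Rightarrow> 'k::field) set"
  assumes V: "finite V" and U: "fun_space.subspace U" "U \<subseteq> supported V"
  shows "fun_space.dim {x \<in> supported V. \<forall>y\<in>U. pairing V x y = 0} + fun_space.dim U = card V"
    (is "fun_space.dim ?W + _ = _")
proof -
  obtain E where E: "E \<subseteq> U" "fun_space.independent E" "U \<subseteq> fun_space.span E"
    using fun_space.maximal_independent_subset by blast
  have EV: "E \<subseteq> supported V" using E U by blast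
  obtain E' where E': "E \<subseteq> E'" "E' \<subseteq> supported V" "fun_space.independent E'"
    "supported V \<subseteq> fun_space.span E'"
    using fun_space.maximal_independent_subset_extend[OF EV E(2)] by blast
  have fin: "finite E'"
    using fun_space.independent_span_bound[OF _ E'(3), of "unit_fun ` V"] E'(2) unit_funs(3)[OF V] V by auto
  then have finE: "finite E" using E'(1) finite_subset by blast
  have cU: "fun_space.dim U = card E" using fun_space.basis_card_eq_dim[OF E(1,3,2)] by simp
  have "fun_space.dim (supported V :: ('z \<Rightarrow> 'k) set) = card (unit_fun ` V :: ('z \<Rightarrow> 'k) set)"
    using fun_space.dim_span_eq_card_independent[OF unit_funs(2)[OF V]] unfolding unit_funs(3)[OF V] .
  then have cV: "card E' = card V"
    using fun_space.basis_card_eq_dim[OF E'(2,4,3)] card_image[OF unit_funs(1)[OF V]] by simp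
  have "\<forall>y. \<exists>\<phi>. Vector_Spaces.linear fscale (*) \<phi> \<and> (\<forall>x\<in>E'. \<phi> x = (if x = y then 1 else 0))"
    by (intro allI fun_space.functional_extend[OF E'(3)])
  then have "\<exists>g. \<forall>y. Vector_Spaces.linear fscale (*) (g y) \<and> (\<forall>x\<in>E'. g y x = (if x = y then 1 else 0))"
    by (rule choice)
  then obtain g where g: "\<And>y. Vector_Spaces.linear fscale (*) (g y)"
    "\<And>y x. x \<in> E' \<Longrightarrow> g y x = (if x = y then 1 else (0::'k))" by blast
  \<comment> \<open>\<open>X y\<close> is the vector that represents the dual functional
    \<open>g y\<close> under the pairing.\<close>
  define X where "X y z = (if z \<in> V then g y (unit_fun z) else 0)" for y z
  have XV: "X y \<in> supported V" for y by (auto simp: X_def supported_def)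
  have X: "pairing V (X y) x = g y x" if "x \<in> supported V" for x y
  proof -
    have "g y x = (\<Sum>z\<in>V. x z * g y (unit_fun z))"
      by (subst supported_expand[OF V that]) (rule fun_space.linear_functional_sum[OF g(1)])
    then show ?thesis by (auto simp: pairing_def X_def mult.commute intro: sum.cong)
  qed
  have dual: "pairing V (X y) x = (if x = y then 1 else 0)" if "x \<in> E'" for x y
    using X g(2) that E'(2) by (metis subsetD)
  have ind: "inj_on X (E' - E)" "fun_space.independent (X ` (E' - E))"
    by (rule fun_space.independent_if_dual[where f = "\<lambda>y x. pairing V x y"];
        use fin dual linear_pairing_left in auto)+
  have "?W = fun_space.span (X ` (E' - E))"
  proof (rule fun_space.span_subspace[symmetric])
    show "X ` (E' - E) \<subseteq> ?W"
    proof clarify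
      fix y assume y: "y \<in> E'" "y \<notin> E"
      have "pairing V (X y) x = 0" if "x \<in> U" for x
      proof (rule fun_space.functional_zero_on_span[OF linear_pairing])
        show "x \<in> fun_space.span E" using E(3) that by blast
        show "pairing V (X y) v = 0" if "v \<in> E" for v using dual[of v y] that y E'(1) by auto
      qed
      then show "X y \<in> supported V \<and> (\<forall>x\<in>U. pairing V (X y) x = 0)" using XV by blast
    qed
    show "fun_space.subspace ?W"
      by (rule fun_space.subspaceI)
        (auto simp: supported_def pairing_def distrib_right sum.distrib mult.assoc
          simp flip: sum_distrib_left)
    show "?W \<subseteq> fun_space.span (X ` (E' - E))"
    proof
      fix x assume x: "x \<in> ?W"
      \<comment> \<open>The candidate expansion of \<open>x\<close>. The difference
        \<open>x - x'\<close> pairs to 0 with all of \<open>E'\<close>, hence with every unit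
        function, and these read off its entries.\<close>
      define x' where "x' = (\<Sum>y\<in>E' - E. fscale (pairing V x y) (X y))"
      have x'V: "x' \<in> supported V" unfolding x'_def
        by (intro fun_space.subspace_sum fun_space.subspace_scale subspace_supported XV)
      have "pairing V (x - x') y = 0" if "y \<in> E'" for y
      proof -
        have "pairing V x' y = (\<Sum>w\<in>E' - E. pairing V x w * pairing V (X w) y)"
          unfolding x'_def by (rule fun_space.linear_functional_sum[OF linear_pairing_left])
        also have "\<dots> = (\<Sum>w\<in>E' - E. if w = y then pairing V x w else 0)"
          using dual[OF that] by (intro sum.cong) auto
        also have "\<dots> = (if y \<in> E then 0 else pairing V x y)" using fin that by simp
        also have "\<dots> = pairing V x y" using x E(1) by auto
        finally show ?thesis by (simp add: pairing_def algebra_simps sum_subtractf)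
      qed
      then have "pairing V (x - x') u = 0" if "u \<in> supported V" for u
        using fun_space.functional_zero_on_span[OF linear_pairing] that E'(4) by blast
      moreover have "unit_fun z \<in> supported V" if "z \<in> V" for z
        using that by (auto simp: supported_def unit_fun_def)
      ultimately have "(x - x') z = 0" if "z \<in> V" for z
        using pairing_unit_fun[OF V that] that by metis
      then have "x z = x' z" for z
        using x x'V by (cases "z \<in> V") (auto simp: supported_def)
      then have "x = x'" by auto
      moreover have "x' \<in> fun_space.span (X ` (E' - E))" unfolding x'_def
        by (rule fun_space.span_sum, rule fun_space.span_scale, rule fun_space.span_base) simp
      ultimately show "x \<in> fun_space.span (X ` (E' - E))" by simp
    qed
  qed
  then have "fun_space.dim ?W = card (E' - E)"
    using fun_space.dim_span_eq_card_independent[OF ind(2)] card_image[OF ind(1)] by simp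
  then show ?thesis
    using cU cV E'(1) finE fin card_mono[OF fin E'(1)] by (simp add: card_Diff_subset)
qed

section \<open>Dual numbers and tangent spaces\<close>

text \<open>The ring k[eps] with eps^2 = 0. A first-order expansion becomes a ring homomorphism into
  it, so that differentials of determinants are computed as determinants over this ring.\<close>

datatype 'a dual = Dual (re: 'a) (eps: 'a)

instantiation dual :: (comm_ring_1) comm_ring_1
begin

definition "0 = Dual 0 0"
definition "1 = Dual 1 0"
definition "x + y = Dual (re x + re y) (eps x + eps y)"
definition "x - y = Dual (re x - re y) (eps x - eps y)"
definition "- x = Dual (- re x) (- eps x)"
definition "x * y = Dual (re x * re y) (re x * eps y + eps x * re y)"

instance
  by standard
    (simp_all add: zero_dual_def one_dual_def plus_dual_def minus_dual_def uminus_dual_def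
      times_dual_def algebra_simps)

end

lemma dual_sel [simp]:
  "re 0 = 0" "eps 0 = 0" "re 1 = 1" "eps 1 = 0"
  "re (x + y) = re x + re y" "eps (x + y) = eps x + eps y"
  "re (x - y) = re x - re y" "eps (x - y) = eps x - eps y"
  "re (- x) = - re x" "eps (- x) = - eps x"
  "re (x * y) = re x * re y" "eps (x * y) = re x * eps y + eps x * re y"
  by (simp_all add: zero_dual_def one_dual_def plus_dual_def minus_dual_def uminus_dual_def
      times_dual_def)

lemma re_sum [simp]: "re (sum f A) = (\<Sum>a\<in>A. re (f a))"
  and eps_sum [simp]: "eps (sum f A) = (\<Sum>a\<in>A. eps (f a))"
  by (induction A rule: infinite_finite_induct) simp_all

text \<open>The differential of \<open>f\<close> at the origin, applied to the direction
  \<open>x\<close>.\<close>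

definition lin_coeff :: "'x set \<Rightarrow> ('x \<Rightarrow> 'k) \<Rightarrow> ('x, 'k::comm_ring_1) mpol \<Rightarrow> 'k" where
  "lin_coeff V x f = (\<Sum>z\<in>V. x z * Poly_Mapping.lookup f (Poly_Mapping.single z 1))"

text \<open>The Taylor expansion to first order at the origin in the direction \<open>x\<close>: the polynomial
  \<open>f\<close> is evaluated at \<open>\<epsilon> x\<close>, with \<open>\<epsilon>\<^sup>2 = 0\<close>.\<close>

definition eval_dual :: "'x set \<Rightarrow> ('x \<Rightarrow> 'k) \<Rightarrow> ('x, 'k::comm_ring_1) mpol \<Rightarrow> 'k dual" where
  "eval_dual V x f = Dual (Poly_Mapping.lookup f 0) (lin_coeff V x f)"

lemma single_one_neq_zero: "Poly_Mapping.single z (1::nat) \<noteq> 0"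
  by (metis keys_single keys_zero insert_not_empty one_neq_zero)

text \<open>A single variable has only trivial factorizations into monomials. This is why the linear
  part of a product has just the two terms of the Leibniz rule.\<close>

lemma single_one_eq_add_iff:
  "l + q = Poly_Mapping.single z (1::nat) \<longleftrightarrow>
    l = 0 \<and> q = Poly_Mapping.single z 1 \<or> l = Poly_Mapping.single z 1 \<and> q = 0"
proof
  assume eq: "l + q = Poly_Mapping.single z 1"
  have "Poly_Mapping.lookup l y + Poly_Mapping.lookup q y = (if y = z then 1 else 0)" for y
    using arg_cong[OF eq, of "\<lambda>f. Poly_Mapping.lookup f y"]
    by (simp add: lookup_add lookup_single when_def eq_commute)
  note sum = this
  have "l = 0 \<or> q = 0"
  proof (cases "Poly_Mapping.lookup l z = 0")
    case True
    have "Poly_Mapping.lookup l y = 0" for y using True sum[of y] by (cases "y = z") simp_all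
    then show ?thesis by (auto intro: poly_mapping_eqI)
  next
    case False
    have "Poly_Mapping.lookup q y = 0" for y using False sum[of y] by (cases "y = z") simp_all
    then show ?thesis by (auto intro: poly_mapping_eqI)
  qed
  then show "l = 0 \<and> q = Poly_Mapping.single z 1 \<or> l = Poly_Mapping.single z 1 \<and> q = 0"
    using eq by auto
qed auto

lemma poly_mapping_add_induct [case_names zero single add]:
  assumes "P 0" "\<And>a b. P (Poly_Mapping.single a b)" "\<And>f g. P f \<Longrightarrow> P g \<Longrightarrow> P (f + g)"
  shows "P (f :: 'a \<Rightarrow>\<^sub>0 'b::comm_monoid_add)"
proof (induction f rule: update_induct)
  case const
  show ?case by (rule assms)
next
  case (update f a b)
  have "Poly_Mapping.update a b f = Poly_Mapping.single a b + f"
    using update(1) by (intro poly_mapping_eqI)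
      (auto simp: lookup_add lookup_single lookup_update when_def in_keys_iff)
  then show ?case using assms update by metis
qed

lemma lin_coeff_add: "lin_coeff V x (f + g) = lin_coeff V x f + lin_coeff V x g"
  by (simp add: lin_coeff_def lookup_add algebra_simps sum.distrib)

lemma lin_coeff_zero [simp]: "lin_coeff V x 0 = 0"
  by (simp add: lin_coeff_def)

lemma eval_dual_add: "eval_dual V x (f + g) = eval_dual V x f + eval_dual V x g"
  by (simp add: eval_dual_def plus_dual_def lookup_add lin_coeff_add)

lemma eval_dual_zero: "eval_dual V x 0 = 0"
  by (simp add: eval_dual_def zero_dual_def)

lemma eval_dual_mult_single:
  "eval_dual V x (Poly_Mapping.single a c * Poly_Mapping.single b c') =
    eval_dual V x (Poly_Mapping.single a c) * eval_dual V x (Poly_Mapping.single b c')"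
proof -
  have "Poly_Mapping.lookup (Poly_Mapping.single (a + b) (c * c')) (Poly_Mapping.single z 1) =
    (if a = 0 then c else 0) * Poly_Mapping.lookup (Poly_Mapping.single b c') (Poly_Mapping.single z 1)
    + Poly_Mapping.lookup (Poly_Mapping.single a c) (Poly_Mapping.single z 1) * (if b = 0 then c' else 0)" for z
  proof -
    have ne: "Poly_Mapping.single z (1::nat) \<noteq> 0" by (rule single_one_neq_zero)
    show ?thesis
      unfolding lookup_single when_def using ne single_one_eq_add_iff[of a b z] by auto
  qed
  moreover have "a + b = 0 \<longleftrightarrow> a = 0 \<and> b = 0"
  proof
    assume *: "a + b = 0"
    have "Poly_Mapping.lookup a y + Poly_Mapping.lookup b y = 0" for y
      using arg_cong[OF *, of "\<lambda>f. Poly_Mapping.lookup f y"] by (simp add: lookup_add)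
    then show "a = 0 \<and> b = 0" by (auto intro: poly_mapping_eqI)
  qed simp
  ultimately show ?thesis
    by (auto simp: eval_dual_def times_dual_def mult_single lin_coeff_def lookup_single when_def
        algebra_simps sum.distrib sum_distrib_left)
qed

lemma eval_dual_mult: "eval_dual V x (f * g) = eval_dual V x f * eval_dual V x g"
proof (induction f rule: poly_mapping_add_induct)
  case (single a b)
  show ?case
    by (induction g rule: poly_mapping_add_induct)
      (simp_all add: eval_dual_mult_single eval_dual_add eval_dual_zero distrib_left)
qed (simp_all add: eval_dual_add eval_dual_zero distrib_right)

lemma eval_dual_one: "eval_dual V x (1 :: ('x, 'k::comm_ring_1) mpol) = 1"
proof -
  have "Poly_Mapping.lookup (1 :: ('x, 'k) mpol) (Poly_Mapping.single z 1) = 0" for z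
    using single_one_neq_zero[of z] by (simp add: lookup_one when_def)
  then show ?thesis by (simp add: eval_dual_def one_dual_def lin_coeff_def)
qed

lemma comm_ring_hom_eval_dual: "comm_ring_hom (eval_dual V x)"
  by unfold_locales (simp_all add: eval_dual_add eval_dual_zero eval_dual_mult eval_dual_one)

lemma lin_coeff_mult:
  "lin_coeff V x (f * g) = Poly_Mapping.lookup f 0 * lin_coeff V x g + lin_coeff V x f * Poly_Mapping.lookup g 0"
  using arg_cong[OF eval_dual_mult, of eps V x f g] by (simp add: eval_dual_def)

text \<open>The real part of \<open>eval_dual\<close> does not depend on the direction, so any
  instance will do; here the set of variables is empty.\<close>

lemma lookup_zero_mult:
  "Poly_Mapping.lookup (f * g :: ('x, 'k::comm_ring_1) mpol) 0 = Poly_Mapping.lookup f 0 * Poly_Mapping.lookup g 0"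
  using arg_cong[OF eval_dual_mult, of re "{}" undefined f g] by (simp add: eval_dual_def)

lemma eval_dual_pconst: "eval_dual V x (pconst c :: ('x, 'k::comm_ring_1) mpol) = Dual c 0"
proof -
  have "Poly_Mapping.lookup (pconst c :: ('x, 'k) mpol) (Poly_Mapping.single z 1) = 0" for z
    using single_one_neq_zero[of z] by (simp add: pconst_def lookup_single when_def)
  then show ?thesis by (simp add: eval_dual_def lin_coeff_def) (simp add: pconst_def)
qed

lemma eval_dual_pvar:
  assumes "finite V" "z \<in> V"
  shows "eval_dual V x (pvar z) = Dual 0 (x z)"
proof -
  have "Poly_Mapping.single z (1::nat) = Poly_Mapping.single y 1 \<longleftrightarrow> z = y" for y
    by (metis keys_single singleton_inject zero_neq_one)
  then have "lin_coeff V x (pvar z) = (\<Sum>y\<in>V. if z = y then x y else 0)"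
    unfolding lin_coeff_def pvar_def lookup_single when_def
    by (intro sum.cong) (auto simp del: One_nat_def)
  also have "\<dots> = x z" using assms by simp
  finally show ?thesis
    using single_one_neq_zero[of z] by (simp add: eval_dual_def pvar_def lookup_single when_def)
qed

section \<open>Ideals of the polynomial ring and the maximal ideal at the origin\<close>

lemma polys_zero: "0 \<in> polys V" and polys_one: "1 \<in> polys V"
  and polys_pconst: "pconst c \<in> polys V"
  by (auto simp: polys_def pconst_def)

lemma polys_pvar: "z \<in> V \<Longrightarrow> pvar z \<in> polys V"
  by (auto simp: polys_def pvar_def)

lemma polys_add: "f \<in> polys V \<Longrightarrow> g \<in> polys V \<Longrightarrow> f + g \<in> polys V"
  unfolding polys_def using Poly_Mapping.keys_add[of f g] by blast

lemma polys_uminus: "f \<in> polys V \<Longrightarrow> - f \<in> polys V"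
  by (simp add: polys_def)

lemma polys_mult:
  assumes "f \<in> polys V" "g \<in> polys V" shows "f * g \<in> polys V"
  unfolding polys_def
proof clarify
  fix m y assume m: "m \<in> Poly_Mapping.keys (f * g)" and y: "y \<in> Poly_Mapping.keys m"
  obtain a b where ab: "m = a + b" "a \<in> Poly_Mapping.keys f" "b \<in> Poly_Mapping.keys g"
    using m keys_mult[of f g] by blast
  then show "y \<in> V" using y Poly_Mapping.keys_add[of a b] assms unfolding polys_def by blast
qed

lemma polys_sum: "(\<And>i. i \<in> I \<Longrightarrow> f i \<in> polys V) \<Longrightarrow> sum f I \<in> polys V"
  by (induction I rule: infinite_finite_induct) (auto intro: polys_zero polys_add)

lemma polys_prod: "(\<And>i. i \<in> I \<Longrightarrow> f i \<in> polys V) \<Longrightarrow> prod f I \<in> polys V"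
  by (induction I rule: infinite_finite_induct) (auto intro: polys_one polys_mult)

lemma ideal_generated_base: "g \<in> G \<Longrightarrow> g \<in> ideal_generated V G"
  unfolding ideal_generated_def
  by (rule CollectI, rule exI[of _ "{g}"], rule exI[of _ "\<lambda>_. 1"]) (simp add: polys_one)

lemma ideal_generated_zero: "0 \<in> ideal_generated V G"
  unfolding ideal_generated_def
  by (rule CollectI, rule exI[of _ "{}"], rule exI[of _ "\<lambda>_. 1"]) simp

lemma origin_ideal_add: "f \<in> origin_ideal V \<Longrightarrow> g \<in> origin_ideal V \<Longrightarrow> f + g \<in> origin_ideal V"
  by (simp add: origin_ideal_def polys_add lookup_add)

lemma origin_ideal_zero: "0 \<in> origin_ideal V"
  by (simp add: origin_ideal_def polys_zero)

lemma origin_ideal_pvar: "z \<in> V \<Longrightarrow> pvar z \<in> origin_ideal V"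
  using polys_pvar[of z V] single_one_neq_zero[of z]
  by (simp add: origin_ideal_def pvar_def lookup_single when_def)

lemma origin_ideal_mult: "f \<in> polys V \<Longrightarrow> g \<in> origin_ideal V \<Longrightarrow> f * g \<in> origin_ideal V"
  by (simp add: origin_ideal_def polys_mult lookup_zero_mult)

lemma origin_ideal_sum: "(\<And>i. i \<in> I \<Longrightarrow> f i \<in> origin_ideal V) \<Longrightarrow> sum f I \<in> origin_ideal V"
  by (induction I rule: infinite_finite_induct) (auto intro: origin_ideal_zero origin_ideal_add)

lemma ideal_generated_subset_origin_ideal:
  assumes "G \<subseteq> origin_ideal V" shows "ideal_generated V G \<subseteq> origin_ideal V"
  using assms unfolding ideal_generated_def by (auto intro!: origin_ideal_sum origin_ideal_mult)

lemma lin_coeff_sum: "lin_coeff V x (sum f I) = (\<Sum>i\<in>I. lin_coeff V x (f i))"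
  by (induction I rule: infinite_finite_induct) (simp_all add: lin_coeff_add)

text \<open>By the Leibniz rule the differential of \<open>h g * g\<close> is a combination of the
  value and the differential of \<open>g\<close> at the origin, and both are 0 for a
  generator.\<close>

lemma lin_coeff_ideal_generated:
  assumes "G \<subseteq> origin_ideal V" "\<And>g. g \<in> G \<Longrightarrow> lin_coeff V x g = 0" "f \<in> ideal_generated V G"
  shows "lin_coeff V x f = 0"
proof -
  obtain F h where F: "F \<subseteq> G" "f = (\<Sum>g\<in>F. h g * g)"
    using assms(3) unfolding ideal_generated_def by blast
  have "lin_coeff V x (h g * g) = 0" if "g \<in> F" for g
  proof -
    have "g \<in> origin_ideal V" "lin_coeff V x g = 0" using that F(1) assms by auto
    then show ?thesis by (simp add: lin_coeff_mult origin_ideal_def)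
  qed
  then show ?thesis unfolding F(2) lin_coeff_sum by simp
qed

lemma poly_mapping_sum_singles:
  "(\<Sum>m\<in>Poly_Mapping.keys f. Poly_Mapping.single m (Poly_Mapping.lookup f m)) = f"
proof (rule poly_mapping_eqI)
  fix k
  show "Poly_Mapping.lookup (\<Sum>m\<in>Poly_Mapping.keys f. Poly_Mapping.single m (Poly_Mapping.lookup f m)) k
      = Poly_Mapping.lookup f k"
    by (simp add: lookup_sum lookup_single when_def in_keys_iff)
qed

text \<open>A functional that vanishes on the square of the maximal ideal is determined by its
  values on the variables, because every monomial of degree at least 2 is a variable times an
  element of the maximal ideal.\<close>

lemma tangent_vector_eq_lin_coeff:
  fixes l :: "('x, 'k::field) mpol \<Rightarrow> 'k"
  assumes V: "finite V"
    and add: "\<And>f g. f \<in> origin_ideal V \<Longrightarrow> g \<in> origin_ideal V \<Longrightarrow> l (f + g) = l f + l g"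
    and scale: "\<And>c f. f \<in> origin_ideal V \<Longrightarrow> l (pconst c * f) = c * l f"
    and mult: "\<And>f g. f \<in> origin_ideal V \<Longrightarrow> g \<in> origin_ideal V \<Longrightarrow> l (f * g) = 0"
    and f: "f \<in> origin_ideal V"
  shows "l f = lin_coeff V (\<lambda>z. if z \<in> V then l (pvar z) else 0) f"
proof -
  let ?x = "\<lambda>z. if z \<in> V then l (pvar z) else 0"
  let ?t = "\<lambda>m. Poly_Mapping.single m (Poly_Mapping.lookup f m)"
  have zero: "l 0 = 0" using scale[OF origin_ideal_zero, of 0] by simp
  have sum: "l (sum t F) = (\<Sum>m\<in>F. l (t m))" if "\<And>m. m \<in> F \<Longrightarrow> t m \<in> origin_ideal V" "finite F"
    for F :: "('x \<Rightarrow>\<^sub>0 nat) set" and t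
    using that(2,1) by (induction F) (auto simp: zero add origin_ideal_sum)
  have *: "?t m \<in> origin_ideal V \<and> l (?t m) = lin_coeff V ?x (?t m)" if m: "m \<in> Poly_Mapping.keys f" for m
  proof -
    let ?c = "Poly_Mapping.lookup f m"
    have m0: "m \<noteq> 0" using m f by (auto simp: origin_ideal_def in_keys_iff)
    have mV: "Poly_Mapping.keys m \<subseteq> V" using m f by (auto simp: origin_ideal_def polys_def)
    have mono: "Poly_Mapping.single m' c \<in> origin_ideal V" if "m' \<noteq> 0" "Poly_Mapping.keys m' \<subseteq> V"
      for m' and c :: 'k
      using that by (auto simp: origin_ideal_def polys_def lookup_single when_def)
    obtain z where z: "z \<in> Poly_Mapping.keys m" using m0 by (metis all_not_in_conv keys_eq_empty)
    have zV: "z \<in> V" using z mV by blast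
    have pz: "(pvar z :: ('x, 'k) mpol) \<in> origin_ideal V" by (rule origin_ideal_pvar[OF zV])
    \<comment> \<open>\<open>m \<noteq> 0\<close> since \<open>f\<close> has no constant term, so a
      variable \<open>z\<close> can be split off. The cofactor is a constant if
      \<open>m' = 0\<close> and lies in the maximal ideal otherwise.\<close>
    define m' where "m' = m - Poly_Mapping.single z 1"
    have mm': "m = Poly_Mapping.single z 1 + m'"
      using z unfolding m'_def
      by (intro poly_mapping_eqI) (auto simp: lookup_add lookup_minus lookup_single when_def in_keys_iff)
    have m'V: "Poly_Mapping.keys m' \<subseteq> V"
      using mV by (auto simp: m'_def lookup_minus in_keys_iff)
    have eq: "?t m = pvar z * Poly_Mapping.single m' ?c"
      unfolding pvar_def mult_single mm'[symmetric] by simp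
    have "l (?t m) = lin_coeff V ?x (?t m)"
    proof (cases "m' = 0")
      case True
      then have "?t m = pconst ?c * pvar z"
        unfolding eq pconst_def by (simp add: mult.commute)
      then show ?thesis
        using scale[OF pz] zV arg_cong[OF eval_dual_pvar[OF V zV, of ?x], of eps]
          arg_cong[OF eval_dual_pconst[of V ?x ?c], of re] pz
        by (simp add: lin_coeff_mult) (simp add: eval_dual_def origin_ideal_def)
    next
      case False
      then have "Poly_Mapping.single m' ?c \<in> origin_ideal V" using mono m'V by blast
      then show ?thesis
        using mult[OF pz, of "Poly_Mapping.single m' ?c"] pz unfolding eq
        by (simp add: lin_coeff_mult origin_ideal_def)
    qed
    then show ?thesis using mono[OF m0 mV] by simp
  qed
  have "l f = (\<Sum>m\<in>Poly_Mapping.keys f. l (?t m))"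
    using sum[of "Poly_Mapping.keys f" ?t] * by (simp add: poly_mapping_sum_singles)
  also have "\<dots> = (\<Sum>m\<in>Poly_Mapping.keys f. lin_coeff V ?x (?t m))"
    using * by (intro sum.cong) auto
  also have "\<dots> = lin_coeff V ?x f"
    by (simp add: lin_coeff_sum[symmetric] poly_mapping_sum_singles)
  finally show ?thesis .
qed

lemma (in vector_space_pair) dim_image_inj_on:
  assumes "Vector_Spaces.linear s1 s2 f" "vs1.subspace S" "inj_on f S"
  shows "vs2.dim (f ` S) = vs1.dim S"
proof -
  interpret f: Vector_Spaces.linear s1 s2 f by fact
  obtain B where B: "B \<subseteq> S" "vs1.independent B" "S \<subseteq> vs1.span B"
    using vs1.maximal_independent_subset by blast
  have S: "vs1.span B = S" by (rule vs1.span_subspace[OF B(1,3) assms(2)])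
  have "vs2.independent (f ` B)"
    using f.independent_injective_image[OF B(2)] assms(3) S by simp
  moreover have "vs2.span (f ` B) = f ` S" using f.span_image S by simp
  ultimately have "vs2.dim (f ` S) = card (f ` B)" using vs2.dim_span_eq_card_independent by metis
  also have "\<dots> = card B" using assms(3) B(1) by (meson card_image inj_on_subset)
  also have "\<dots> = vs1.dim S" by (rule vs1.basis_card_eq_dim[OF B(1,3,2)])
  finally show ?thesis .
qed

text \<open>The isomorphism \<open>\<tau>\<close> sends a direction to its directional derivative on
  the maximal ideal, extended by 0 as the definition of the tangent space demands. Its inverse reads
  off the values on the variables.\<close>

lemma tangent_dim_eq:
  fixes I :: "('x, 'k::field) mpol set"
  assumes V: "finite V" and I: "I \<subseteq> origin_ideal V"
  shows "tangent_dim V I = fun_space.dim {x \<in> supported V. \<forall>f\<in>I. lin_coeff V x f = 0}"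
proof -
  let ?X = "{x \<in> supported V. \<forall>f\<in>I. lin_coeff V x f = 0}"
  define \<tau> where "\<tau> x f = (if f \<in> origin_ideal V then lin_coeff V x f else 0)" for x and f :: "('x, 'k) mpol"
  have "vector_space_pair (fscale :: 'k \<Rightarrow> ('x \<Rightarrow> 'k) \<Rightarrow> _) (fscale :: 'k \<Rightarrow> (('x, 'k) mpol \<Rightarrow> 'k) \<Rightarrow> _)"
    by (intro vector_space_pair.intro vector_space_functionals)
  then interpret pr: vector_space_pair "fscale :: 'k \<Rightarrow> ('x \<Rightarrow> 'k) \<Rightarrow> _" "fscale :: 'k \<Rightarrow> (('x, 'k) mpol \<Rightarrow> 'k) \<Rightarrow> _" .
  have linc: "lin_coeff V (x + y) f = lin_coeff V x f + lin_coeff V y f"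
    "lin_coeff V (\<lambda>z. c * x z) f = c * lin_coeff V x f" "lin_coeff V 0 f = 0" for x y c and f :: "('x, 'k) mpol"
    by (simp_all add: lin_coeff_def distrib_right sum.distrib sum_distrib_left mult.assoc)
  have lin: "Vector_Spaces.linear fscale fscale \<tau>"
    unfolding Vector_Spaces.linear_iff
    by (intro conjI allI vector_space_functionals) (simp_all add: \<tau>_def[abs_def] linc fun_eq_iff)
  have lin_pvar: "lin_coeff V x (pvar z) = x z" if "z \<in> V" for x :: "'x \<Rightarrow> 'k" and z
    using arg_cong[OF eval_dual_pvar[OF V that, of x], of eps] by (simp add: eval_dual_def)
  have sub: "fun_space.subspace ?X"
    using subspace_supported[of V] unfolding fun_space.subspace_def
    by (auto simp: linc)
  have inj: "inj_on \<tau> ?X"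
  proof (rule inj_onI, rule ext)
    fix x y z assume xy: "x \<in> ?X" "y \<in> ?X" "\<tau> x = \<tau> y"
    show "x z = y z"
    proof (cases "z \<in> V")
      case True
      then show ?thesis using fun_cong[OF xy(3), of "pvar z"] lin_pvar[OF True]
        by (simp add: \<tau>_def origin_ideal_pvar[OF True])
    qed (use xy in \<open>auto simp: supported_def\<close>)
  qed
  have "\<tau> ` ?X = zariski_tangent_space V I"
  proof (intro subset_antisym subsetI)
    fix l assume "l \<in> \<tau> ` ?X"
    then obtain x where x: "x \<in> ?X" "l = \<tau> x" by blast
    have "pconst c * f \<in> origin_ideal V" if "f \<in> origin_ideal V" for c and f :: "('x, 'k) mpol"
      using that origin_ideal_mult polys_pconst by blast
    moreover have "lin_coeff V x (pconst c * f) = c * lin_coeff V x f" if "f \<in> origin_ideal V" for c f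
      using arg_cong[OF eval_dual_mult, of eps V x "pconst c" f]
      unfolding eval_dual_pconst by (simp add: eval_dual_def)
    moreover have "lin_coeff V x (f * g) = 0" if "f \<in> origin_ideal V" "g \<in> origin_ideal V" for f g
      using that by (simp add: lin_coeff_mult origin_ideal_def)
    ultimately show "l \<in> zariski_tangent_space V I"
      using x I by (auto simp: zariski_tangent_space_def Let_def \<tau>_def origin_ideal_add lin_coeff_add)
  next
    fix l assume "l \<in> zariski_tangent_space V I"
    then have l: "\<And>f g. f \<in> origin_ideal V \<Longrightarrow> g \<in> origin_ideal V \<Longrightarrow> l (f + g) = l f + l g"
      "\<And>c f. f \<in> origin_ideal V \<Longrightarrow> l (pconst c * f) = c * l f"
      "\<And>f g. f \<in> origin_ideal V \<Longrightarrow> g \<in> origin_ideal V \<Longrightarrow> l (f * g) = 0"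
      and lI: "\<And>f. f \<in> I \<Longrightarrow> l f = 0" and l0: "\<And>f. f \<notin> origin_ideal V \<Longrightarrow> l f = 0"
      by (auto simp: zariski_tangent_space_def Let_def)
    define x where "x z = (if z \<in> V then l (pvar z) else 0)" for z
    have lf: "l f = lin_coeff V x f" if "f \<in> origin_ideal V" for f
      using tangent_vector_eq_lin_coeff[OF V l that] by (simp add: x_def[abs_def])
    then have "l = \<tau> x" using l0 by (auto simp: \<tau>_def)
    moreover have "lin_coeff V x f = 0" if "f \<in> I" for f
      using lf[of f] lI[OF that] I that by auto
    then have "x \<in> ?X" by (auto simp: x_def supported_def)
    ultimately show "l \<in> \<tau> ` ?X" by blast
  qed
  then show ?thesis
    unfolding tangent_dim_def using pr.dim_image_inj_on[OF lin sub inj] by simp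
qed

text \<open>Only the differentials of the generators matter: since 0 lies in either ideal, the sum
  contains both sets of generators, and the Leibniz rule covers the remaining elements.\<close>

lemma tangent_dim_sum_ideals:
  fixes G G' :: "('x, 'k::field) mpol set"
  assumes V: "finite V" and G: "G \<subseteq> origin_ideal V" "G' \<subseteq> origin_ideal V"
  shows "tangent_dim V {f + g | f g. f \<in> ideal_generated V G \<and> g \<in> ideal_generated V G'} =
    fun_space.dim {x \<in> supported V. \<forall>f\<in>G \<union> G'. lin_coeff V x f = 0}"
proof -
  let ?I = "{f + g | f g. f \<in> ideal_generated V G \<and> g \<in> ideal_generated V G'}"
  have "?I \<subseteq> origin_ideal V"
    using ideal_generated_subset_origin_ideal[OF G(1)] ideal_generated_subset_origin_ideal[OF G(2)]
    by (auto intro: origin_ideal_add)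
  moreover have "(\<forall>f\<in>?I. lin_coeff V x f = 0) \<longleftrightarrow> (\<forall>f\<in>G \<union> G'. lin_coeff V x f = 0)" for x
  proof
    assume *: "\<forall>f\<in>?I. lin_coeff V x f = 0"
    have "f \<in> ?I" if "f \<in> G \<union> G'" for f
      using that ideal_generated_base[of f G V] ideal_generated_base[of f G' V] ideal_generated_zero
      by (metis (mono_tags, lifting) Un_iff add.right_neutral add_0 mem_Collect_eq)
    then show "\<forall>f\<in>G \<union> G'. lin_coeff V x f = 0" using * by blast
  next
    assume *: "\<forall>f\<in>G \<union> G'. lin_coeff V x f = 0"
    show "\<forall>f\<in>?I. lin_coeff V x f = 0"
    proof clarify
      fix f g assume "f \<in> ideal_generated V G" "g \<in> ideal_generated V G'"
      then have "lin_coeff V x f = 0" "lin_coeff V x g = 0"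
        using lin_coeff_ideal_generated[OF G(1), of x f] lin_coeff_ideal_generated[OF G(2), of x g] *
        by blast+
      then show "lin_coeff V x (f + g) = 0" by (simp add: lin_coeff_add)
    qed
  qed
  ultimately show ?thesis using tangent_dim_eq[OF V, of ?I] by presburger
qed

section \<open>First-order expansion of minors\<close>

lemma det_zero_row:
  assumes "A \<in> carrier_mat n n" "i < n" "\<And>j. j < n \<Longrightarrow> A $$ (i, j) = 0"
  shows "det A = (0 :: 'a::comm_ring_1)"
  unfolding laplace_expansion_row[OF assms(1,2)] using assms(3) by simp

text \<open>Stated for a product rather than for a rank, since it is applied over the dual numbers.
  Padding both factors to square matrices gives the second one a zero row.\<close>

lemma det_product_zero:
  fixes f g :: "nat \<Rightarrow> nat \<Rightarrow> 'a::comm_ring_1"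
  shows "det (mat (Suc n) (Suc n) (\<lambda>(p, q). \<Sum>s<n. f p s * g s q)) = 0"
proof -
  let ?A = "mat (Suc n) (Suc n) (\<lambda>(p, s). if s < n then f p s else 0)"
  let ?B = "mat (Suc n) (Suc n) (\<lambda>(s, q). if s < n then g s q else 0)"
  have "mat (Suc n) (Suc n) (\<lambda>(p, q). \<Sum>s<n. f p s * g s q) = ?A * ?B"
  proof (rule eq_matI)
    fix p q assume pq: "p < dim_row (?A * ?B)" "q < dim_col (?A * ?B)"
    have "(?A * ?B) $$ (p, q) = (\<Sum>s\<in>{0..<Suc n}. ?A $$ (p, s) * ?B $$ (s, q))"
      using pq by (simp add: scalar_prod_def)
    also have "\<dots> = (\<Sum>s<n. f p s * g s q)"
      using pq by (simp add: atLeast0LessThan)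
    finally show "mat (Suc n) (Suc n) (\<lambda>(p, q). \<Sum>s<n. f p s * g s q) $$ (p, q) = (?A * ?B) $$ (p, q)"
      using pq by simp
  qed simp_all
  moreover have "det (?A * ?B) = det ?A * det ?B" by (rule det_mult[of _ "Suc n"]) simp_all
  moreover have "det ?B = 0" by (rule det_zero_row[of _ "Suc n" n]) simp_all
  ultimately show ?thesis by simp
qed

lemma comm_ring_hom_re: "comm_ring_hom (re :: 'a::comm_ring_1 dual \<Rightarrow> 'a)"
  by unfold_locales simp_all

lemma polys_det:
  assumes "\<And>p q. p < n \<Longrightarrow> q < n \<Longrightarrow> f (p, q) \<in> polys V"
  shows "det (mat n n f) \<in> polys V"
  unfolding det_def'[OF mat_carrier]
proof (rule polys_sum)
  fix p assume "p \<in> {p. p permutes {0..<n}}"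
  then have "i < n \<Longrightarrow> p i < n" for i by (auto dest: permutes_in_image[of p _ i])
  then have "(\<Prod>i = 0..<n. mat n n f $$ (i, p i)) \<in> polys V"
    using assms by (intro polys_prod) simp
  then show "signof p * (\<Prod>i = 0..<n. mat n n f $$ (i, p i)) \<in> polys V"
    by (cases "signof p = (1 :: ('a, 'b) mpol)") (auto simp: sign_def polys_uminus)
qed

lemma sum_lessThan_add:
  "(\<Sum>s<n + m. f s) = (\<Sum>s<n. f s) + (\<Sum>k<m. f (n + k) :: 'a::comm_monoid_add)" for n m :: nat
  by (induction m) (simp_all add: add.assoc)

section \<open>The affine chart of the Grassmannian centred at L\<close>

locale adapted_chart = finite_dimensional_vector_space scale Basis
  for scale :: "'k::field \<Rightarrow> 'v::ab_group_add \<Rightarrow> 'v" (infixr \<open>*s\<close> 75) and Basis :: "'v set" +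
  fixes d r :: nat and L :: "'v set" and e :: "nat \<Rightarrow> 'v"
  assumes d_def: "d = dim UNIV" and r_less: "r < d" and frame: "adapted_frame scale r L e"
begin

lemma frame_basis:
  "inj_on e {..<d}" "independent (e ` {..<d})" "span (e ` {..<d}) = UNIV" "span (e ` {..r}) = L"
  using frame unfolding adapted_frame_def Let_def d_def by simp_all

lemma subspace_L: "subspace L"
  using frame_basis(4) subspace_span by metis

lemma frame_in_L: "j \<le> r \<Longrightarrow> e j \<in> L"
  unfolding frame_basis(4)[symmetric] by (intro span_base) simp

lemma dim_L: "dim L = r + 1"
proof -
  have sub: "{..r} \<subseteq> {..<d}" using r_less by auto
  have "independent (e ` {..r})" "inj_on e {..r}"
    using independent_mono[OF frame_basis(2) image_mono[OF sub]] inj_on_subset[OF frame_basis(1) sub]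
    by simp_all
  then show ?thesis
    unfolding frame_basis(4)[symmetric] by (simp add: dim_eq_card_independent card_image)
qed

definition coord :: "nat \<Rightarrow> 'v \<Rightarrow> 'k" where
  "coord = (SOME f. (\<forall>m<d. Vector_Spaces.linear scale (*) (f m)) \<and>
    (\<forall>m<d. \<forall>l<d. f m (e l) = (if m = l then 1 else 0)) \<and>
    (\<forall>h. (\<Sum>m<d. f m h *s e m) = h))"

lemma coord:
  shows linear_coord: "m < d \<Longrightarrow> Vector_Spaces.linear scale (*) (coord m)"
    and coord_frame: "m < d \<Longrightarrow> l < d \<Longrightarrow> coord m (e l) = (if m = l then 1 else 0)"
    and coord_sum: "(\<Sum>m<d. coord m h *s e m) = h"
  using someI_ex[OF dual_basis[OF frame_basis(1-3)]] unfolding coord_def[symmetric] by blast+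

lemma coord_add: "m < d \<Longrightarrow> coord m (h + h') = coord m h + coord m h'"
  and coord_scale: "m < d \<Longrightarrow> coord m (c *s h) = c * coord m h"
  using linear_coord by (simp_all add: linear_functional_iff)

lemma coord_L:
  assumes "v \<in> L" "r < m" "m < d" shows "coord m v = 0"
  by (rule functional_zero_on_span[OF linear_coord[OF assms(3)], of "e ` {..r}"])
    (use assms coord_frame frame_basis(4) r_less in auto)

lemma coord_sum_L:
  assumes "v \<in> L" shows "(\<Sum>j\<le>r. coord j v *s e j) = v"
proof -
  have "(\<Sum>j\<le>r. coord j v *s e j) = (\<Sum>m<d. coord m v *s e m)"
    using r_less coord_L[OF assms] by (intro sum.mono_neutral_left) auto
  then show ?thesis using coord_sum by simp
qed

abbreviation V :: "(nat \<times> nat) set" where "V \<equiv> chart_vars d r"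

lemma finite_V: "finite V"
  by (simp add: chart_vars_def)

lemma card_V: "card V = (r + 1) * (d - r - 1)"
  by (simp add: chart_vars_def)

text \<open>A point \<open>x\<close> of the chart corresponds to the linear map \<open>L \<rightarrow> H / L\<close> whose composition
  with \<open>H / L \<cong> C\<close> is \<open>tmap x\<close>.\<close>

definition col :: "(nat \<times> nat \<Rightarrow> 'k) \<Rightarrow> nat \<Rightarrow> 'v" where
  "col x j = (\<Sum>l = r + 1..<d. x (l, j) *s e l)"

definition tmap :: "(nat \<times> nat \<Rightarrow> 'k) \<Rightarrow> 'v \<Rightarrow> 'v" where
  "tmap x v = (\<Sum>j\<le>r. coord j v *s col x j)"

lemma tmap_add: "tmap x (v + v') = tmap x v + tmap x v'"
  using r_less by (simp add: tmap_def coord_add scale_left_distrib sum.distrib)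

lemma tmap_scale: "tmap x (c *s v) = c *s tmap x v"
  using r_less by (simp add: tmap_def coord_scale scale_sum_right)

lemma tmap_sum: "tmap x (\<Sum>i\<in>I. c i *s v i) = (\<Sum>i\<in>I. c i *s tmap x (v i))"
proof -
  have "tmap x 0 = 0" using tmap_scale[of x 0 0] by simp
  then show ?thesis by (induction I rule: infinite_finite_induct) (simp_all add: tmap_add tmap_scale)
qed

lemma tmap_frame:
  assumes "j \<le> r" shows "tmap x (e j) = col x j"
proof -
  have "tmap x (e j) = (\<Sum>i\<le>r. (if i = j then col x i else 0))"
    unfolding tmap_def using assms r_less by (intro sum.cong) (auto simp: coord_frame)
  then show ?thesis using assms by simp
qed

text \<open>At the point eps x of the chart the j-th basis vector of the universal subspace is
  \<open>e j\<close> + eps \<open>col x j\<close>.\<close>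

lemma eval_dual_chart_entry:
  assumes "Vector_Spaces.linear scale (*) \<phi>" "j \<le> r"
  shows "eval_dual V x (chart_entry d r e \<phi> j) = Dual (\<phi> (e j)) (\<phi> (col x j))"
proof -
  interpret h: comm_ring_hom "eval_dual V x" by (rule comm_ring_hom_eval_dual)
  have "eval_dual V x (pvar (l, j)) = Dual 0 (x (l, j))" if "l \<in> {r + 1..<d}" for l
    using that assms(2) by (intro eval_dual_pvar finite_V) (simp add: chart_vars_def)
  then have "eval_dual V x (chart_entry d r e \<phi> j) =
      Dual (\<phi> (e j)) 0 + (\<Sum>l = r + 1..<d. Dual (\<phi> (e l)) 0 * Dual 0 (x (l, j)))"
    unfolding chart_entry_def h.hom_add h.hom_sum h.hom_mult eval_dual_pconst by simp
  also have "\<dots> = Dual (\<phi> (e j)) (\<phi> (col x j))"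
    unfolding col_def linear_functional_sum[OF assms(1)]
    by (intro dual.expand) (simp add: mult.commute)
  finally show ?thesis .
qed

lemma chart_entry_polys: "j \<le> r \<Longrightarrow> chart_entry d r e \<phi> j \<in> polys V"
  unfolding chart_entry_def
  by (intro polys_add polys_pconst polys_sum polys_mult polys_pvar) (simp add: chart_vars_def)

lemma chart_minorsE:
  assumes "g \<in> chart_minors scale r e S n"
  obtains \<phi> c where "\<And>p. p < n \<Longrightarrow> \<phi> p \<in> annihilator scale S" "\<And>q. q < n \<Longrightarrow> c q \<le> r"
    and "g = det (mat n n (\<lambda>(p, q). chart_entry d r e (\<phi> p) (c q)))"
  using assms unfolding chart_minors_def d_def by blast

lemma eval_dual_minor:
  assumes "\<And>p. p < n \<Longrightarrow> \<phi> p \<in> annihilator scale S" "\<And>q. q < n \<Longrightarrow> c q \<le> r"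
  shows "eval_dual V x (det (mat n n (\<lambda>(p, q). chart_entry d r e (\<phi> p) (c q)))) =
    det (mat n n (\<lambda>(p, q). Dual (\<phi> p (e (c q))) (\<phi> p (col x (c q)))))"
proof -
  interpret h: comm_ring_hom "eval_dual V x" by (rule comm_ring_hom_eval_dual)
  have "map_mat (eval_dual V x) (mat n n (\<lambda>(p, q). chart_entry d r e (\<phi> p) (c q))) =
      mat n n (\<lambda>(p, q). Dual (\<phi> p (e (c q))) (\<phi> p (col x (c q))))"
    using assms by (intro eq_matI) (simp_all add: annihilator_def eval_dual_chart_entry)
  then show ?thesis unfolding h.hom_det[symmetric] by simp
qed

lemma chart_minors_polys: "g \<in> chart_minors scale r e S n \<Longrightarrow> g \<in> polys V"
  by (erule chart_minorsE) (auto intro!: polys_det chart_entry_polys)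

section \<open>Bounded rank over the dual numbers as a factorization\<close>

text \<open>To first order in the direction \<open>x\<close>, the map from the universal subspace to \<open>H / S\<close>
  factors through a free module of rank \<open>n\<close> over the dual numbers.\<close>

definition factors :: "(nat \<times> nat \<Rightarrow> 'k) \<Rightarrow> 'v set \<Rightarrow> nat \<Rightarrow> bool" where
  "factors x S n \<longleftrightarrow> (\<exists>w w' \<beta> \<beta>'. \<forall>j\<le>r.
     e j - (\<Sum>s<n. \<beta> s j *s w s) \<in> S \<and>
     col x j - (\<Sum>s<n. \<beta> s j *s w' s + \<beta>' s j *s w s) \<in> S)"

text \<open>Modulo \<open>S\<close>, the vector \<open>e j\<close> + eps \<open>col x j\<close> is
  the sum of the products of \<open>\<beta> s j\<close> + eps \<open>\<beta>' s j\<close> with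
  \<open>w s\<close> + eps \<open>w' s\<close>. The matrix of the minor is thus a product through
  size \<open>n\<close>, and its constant and linear parts vanish together.\<close>

lemma eval_dual_chart_minor_factors:
  assumes "factors x S n" "g \<in> chart_minors scale r e S (n + 1)"
  shows "eval_dual V x g = 0"
proof -
  obtain \<phi> c where \<phi>: "\<And>p. p < n + 1 \<Longrightarrow> \<phi> p \<in> annihilator scale S"
    and c: "\<And>q. q < n + 1 \<Longrightarrow> c q \<le> r"
    and g: "g = det (mat (n + 1) (n + 1) (\<lambda>(p, q). chart_entry d r e (\<phi> p) (c q)))"
    using assms(2) by (rule chart_minorsE) blast
  obtain w w' \<beta> \<beta>' where f: "\<And>j. j \<le> r \<Longrightarrow> e j - (\<Sum>s<n. \<beta> s j *s w s) \<in> S"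
    "\<And>j. j \<le> r \<Longrightarrow> col x j - (\<Sum>s<n. \<beta> s j *s w' s + \<beta>' s j *s w s) \<in> S"
    using assms(1) unfolding factors_def by blast
  have "Dual (\<phi> p (e (c q))) (\<phi> p (col x (c q))) =
    (\<Sum>s<n. Dual (\<phi> p (w s)) (\<phi> p (w' s)) * Dual (\<beta> s (c q)) (\<beta>' s (c q)))" if "p < n + 1" "q < n + 1" for p q
  proof -
    have lin: "Vector_Spaces.linear scale (*) (\<phi> p)" and S: "\<And>u. u \<in> S \<Longrightarrow> \<phi> p u = 0"
      using \<phi>[OF that(1)] by (auto simp: annihilator_def)
    interpret l: Vector_Spaces.linear scale "(*)" "\<phi> p" by (rule lin)
    have "\<phi> p (e (c q)) = (\<Sum>s<n. \<beta> s (c q) * \<phi> p (w s))"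
      using S[OF f(1)[OF c[OF that(2)]]] by (simp add: l.diff l.sum l.scale)
    moreover have "\<phi> p (col x (c q)) = (\<Sum>s<n. \<beta> s (c q) * \<phi> p (w' s) + \<beta>' s (c q) * \<phi> p (w s))"
      using S[OF f(2)[OF c[OF that(2)]]] by (simp add: l.diff l.sum l.scale l.add)
    ultimately show ?thesis
      by (intro dual.expand) (simp add: mult.commute)
  qed
  then have "mat (Suc n) (Suc n) (\<lambda>(p, q). Dual (\<phi> p (e (c q))) (\<phi> p (col x (c q)))) =
    mat (Suc n) (Suc n) (\<lambda>(p, q). \<Sum>s<n. Dual (\<phi> p (w s)) (\<phi> p (w' s)) * Dual (\<beta> s (c q)) (\<beta>' s (c q)))"
    by (intro eq_matI) simp_all
  moreover have "eval_dual V x g =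
      det (mat (n + 1) (n + 1) (\<lambda>(p, q). Dual (\<phi> p (e (c q))) (\<phi> p (col x (c q)))))"
    unfolding g by (rule eval_dual_minor[OF \<phi> c])
  ultimately show ?thesis by (simp add: det_product_zero)
qed

text \<open>The \<open>w s\<close> are the vectors appended when a basis of
  \<open>A \<inter> B\<close> is extended to one of \<open>A\<close>; they generate \<open>A\<close>
  modulo \<open>A \<inter> B\<close>.\<close>

lemma complement_vectors:
  assumes "subspace A" "subspace B"
  shows "\<exists>w. (\<forall>s<dim A - dim (A \<inter> B). w s \<in> A) \<and>
    (\<forall>h\<in>A. \<exists>\<beta>. h - (\<Sum>s<dim A - dim (A \<inter> B). \<beta> s *s w s) \<in> A \<inter> B)"
proof -
  let ?m = "dim (A \<inter> B)" and ?n = "dim A - dim (A \<inter> B)"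
  have sAB: "subspace (A \<inter> B)" by (rule subspace_inter[OF assms])
  have le: "?m \<le> dim A" by (intro dim_subset) simp
  obtain v0 where v0: "span (v0 ` {..<?m}) = A \<inter> B" "inj_on v0 {..<?m}" "independent (v0 ` {..<?m})"
    using indexed_basis_extend[OF sAB, of "{0}" "\<lambda>_. 0" 0] subspace_0[OF sAB] independent_empty by auto
  obtain v where v: "\<And>i. i < ?m \<Longrightarrow> v i = v0 i" "span (v ` {..<dim A}) = A" "inj_on v {..<dim A}"
    using indexed_basis_extend[OF assms(1) _ v0] by blast
  have vAB: "v i \<in> A \<inter> B" if "i < ?m" for i
    using v(1)[OF that] v0(1) span_base[of "v0 i" "v0 ` {..<?m}"] that by auto
  have "\<exists>\<beta>. h - (\<Sum>s<?n. \<beta> s *s v (?m + s)) \<in> A \<inter> B" if "h \<in> A" for h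
  proof -
    have "h \<in> span (v ` {..<dim A})" using that v(2) by simp
    then obtain u where "h = (\<Sum>y\<in>v ` {..<dim A}. u y *s y)"
      by (subst (asm) span_finite) auto
    then have "h = (\<Sum>i<dim A. u (v i) *s v i)" by (simp add: sum.reindex[OF v(3)])
    also have "\<dots> = (\<Sum>i<?m + ?n. u (v i) *s v i)" using le by simp
    also have "\<dots> = (\<Sum>i<?m. u (v i) *s v i) + (\<Sum>s<?n. u (v (?m + s)) *s v (?m + s))"
      by (rule sum_lessThan_add)
    finally have "h - (\<Sum>s<?n. u (v (?m + s)) *s v (?m + s)) = (\<Sum>i<?m. u (v i) *s v i)" by simp
    also have "\<dots> \<in> A \<inter> B" using vAB by (intro subspace_sum subspace_scale sAB) simp
    finally show ?thesis by (rule exI[of _ "\<lambda>s. u (v (?m + s))"])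
  qed
  moreover have "v (?m + s) \<in> A" if "s < ?n" for s
    using v(2) span_base[of "v (?m + s)" "v ` {..<dim A}"] that by auto
  ultimately show ?thesis by (intro exI[of _ "\<lambda>s. v (?m + s)"]) blast
qed

lemma factors_UNIV: "factors x UNIV 0"
  by (simp add: factors_def)

text \<open>The residues of both expansions lie in \<open>S\<close>, so modulo \<open>S'\<close>
  they are combinations of \<open>dim S - dim S'\<close> fixed vectors \<open>u k\<close>. These
  join the \<open>w s\<close> with first-order part 0; their coefficients carry the residues of both
  orders.\<close>

lemma factors_subspace:
  assumes "factors x S n" "subspace S" "subspace S'" "S' \<subseteq> S"
  shows "factors x S' (n + (dim S - dim S'))"
proof -
  let ?m = "dim S - dim S'"
  obtain w w' \<beta> \<beta>' where f: "\<And>j. j \<le> r \<Longrightarrow> e j - (\<Sum>s<n. \<beta> s j *s w s) \<in> S"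
    "\<And>j. j \<le> r \<Longrightarrow> col x j - (\<Sum>s<n. \<beta> s j *s w' s + \<beta>' s j *s w s) \<in> S"
    using assms(1) unfolding factors_def by blast
  have SS': "S \<inter> S' = S'" using assms(4) by blast
  obtain u where u: "\<And>h. h \<in> S \<Longrightarrow> \<exists>\<gamma>. h - (\<Sum>k<?m. \<gamma> k *s u k) \<in> S'"
    using complement_vectors[OF assms(2,3)] unfolding SS' by blast
  have "\<forall>j. \<exists>\<gamma>. j \<le> r \<longrightarrow> e j - (\<Sum>s<n. \<beta> s j *s w s) - (\<Sum>k<?m. \<gamma> k *s u k) \<in> S'"
    using u[OF f(1)] by blast
  from choice[OF this] obtain \<gamma> where "\<forall>j. j \<le> r \<longrightarrow>
      e j - (\<Sum>s<n. \<beta> s j *s w s) - (\<Sum>k<?m. \<gamma> j k *s u k) \<in> S'" ..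
  then have \<gamma>: "e j - (\<Sum>s<n. \<beta> s j *s w s) - (\<Sum>k<?m. \<gamma> j k *s u k) \<in> S'" if "j \<le> r" for j
    using that by blast
  have "\<forall>j. \<exists>\<gamma>. j \<le> r \<longrightarrow>
      col x j - (\<Sum>s<n. \<beta> s j *s w' s + \<beta>' s j *s w s) - (\<Sum>k<?m. \<gamma> k *s u k) \<in> S'"
    using u[OF f(2)] by blast
  from choice[OF this] obtain \<gamma>' where "\<forall>j. j \<le> r \<longrightarrow>
      col x j - (\<Sum>s<n. \<beta> s j *s w' s + \<beta>' s j *s w s) - (\<Sum>k<?m. \<gamma>' j k *s u k) \<in> S'" ..
  then have \<gamma>': "col x j - (\<Sum>s<n. \<beta> s j *s w' s + \<beta>' s j *s w s) - (\<Sum>k<?m. \<gamma>' j k *s u k) \<in> S'" if "j \<le> r" for j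
    using that by blast
  define ww where "ww s = (if s < n then w s else u (s - n))" for s
  define ww' where "ww' s = (if s < n then w' s else 0)" for s
  define b where "b s j = (if s < n then \<beta> s j else \<gamma> j (s - n))" for s j
  define b' where "b' s j = (if s < n then \<beta>' s j else \<gamma>' j (s - n))" for s j
  have "(\<Sum>s<n + ?m. b s j *s ww s) = (\<Sum>s<n. \<beta> s j *s w s) + (\<Sum>k<?m. \<gamma> j k *s u k)" for j
    unfolding sum_lessThan_add by (simp add: ww_def b_def)
  moreover have "(\<Sum>s<n + ?m. b s j *s ww' s + b' s j *s ww s) =
      (\<Sum>s<n. \<beta> s j *s w' s + \<beta>' s j *s w s) + (\<Sum>k<?m. \<gamma>' j k *s u k)" for j
    unfolding sum_lessThan_add by (simp add: ww_def ww'_def b_def b'_def)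
  ultimately have "e j - (\<Sum>s<n + ?m. b s j *s ww s) \<in> S' \<and>
      col x j - (\<Sum>s<n + ?m. b s j *s ww' s + b' s j *s ww s) \<in> S'" if "j \<le> r" for j
    using \<gamma>[OF that] \<gamma>'[OF that] by (simp only: diff_diff_eq)
  then show ?thesis unfolding factors_def by blast
qed

text \<open>The \<open>w s\<close> generate \<open>L\<close> modulo \<open>L \<inter> S\<close> and
  are displaced to \<open>w s\<close> + eps \<open>tmap x (w s)\<close>. What remains of
  \<open>e j\<close> is a vector of \<open>L \<inter> S\<close>, whose image splits by assumption
  into a part in \<open>S\<close> and a part in \<open>L\<close>; the latter is a combination of the
  \<open>w s\<close> modulo \<open>S\<close> and goes into \<open>\<beta>'\<close>.\<close>

lemma factors_if_tmap:
  assumes S: "subspace S" and dimS: "dim (L \<inter> S) + n = r + 1"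
    and t: "\<And>v. v \<in> L \<inter> S \<Longrightarrow> tmap x v \<in> {s + l | s l. s \<in> S \<and> l \<in> L}"
  shows "factors x S n"
proof -
  have n: "dim L - dim (L \<inter> S) = n" using dimS dim_L by simp
  obtain w where w: "\<And>h. h \<in> L \<Longrightarrow> \<exists>\<beta>. h - (\<Sum>s<n. \<beta> s *s w s) \<in> L \<inter> S"
    using complement_vectors[OF subspace_L S] unfolding n by blast
  have "\<forall>j. \<exists>\<beta>. j \<le> r \<longrightarrow> e j - (\<Sum>s<n. \<beta> s *s w s) \<in> L \<inter> S" using w frame_in_L by blast
  from choice[OF this] obtain \<beta> where "\<forall>j. j \<le> r \<longrightarrow>
      e j - (\<Sum>s<n. \<beta> j s *s w s) \<in> L \<inter> S" ..
  then have \<beta>: "e j - (\<Sum>s<n. \<beta> j s *s w s) \<in> L \<inter> S" if "j \<le> r" for j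
    using that by blast
  have "\<exists>\<beta>'. col x j - (\<Sum>s<n. \<beta> j s *s tmap x (w s) + \<beta>' s *s w s) \<in> S" if j: "j \<le> r" for j
  proof -
    let ?v = "e j - (\<Sum>s<n. \<beta> j s *s w s)"
    obtain s l where sl: "tmap x ?v = s + l" "s \<in> S" "l \<in> L" using t[OF \<beta>[OF j]] by blast
    obtain \<beta>' where \<beta>': "l - (\<Sum>s<n. \<beta>' s *s w s) \<in> L \<inter> S" using w[OF sl(3)] by blast
    have "e j = ?v + (\<Sum>s<n. \<beta> j s *s w s)" by simp
    then have "col x j = tmap x ?v + (\<Sum>s<n. \<beta> j s *s tmap x (w s))"
      using tmap_frame[OF j, of x] tmap_add tmap_sum by metis
    then have "col x j - (\<Sum>s<n. \<beta> j s *s tmap x (w s) + \<beta>' s *s w s) = s + (l - (\<Sum>s<n. \<beta>' s *s w s))"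
      by (simp add: sl(1) sum.distrib)
    also have "\<dots> \<in> S" using sl(2) \<beta>' S by (intro subspace_add) auto
    finally show ?thesis by (rule exI[of _ \<beta>'])
  qed
  then have "\<forall>j. \<exists>\<beta>'. j \<le> r \<longrightarrow> col x j - (\<Sum>s<n. \<beta> j s *s tmap x (w s) + \<beta>' s *s w s) \<in> S" by blast
  from choice[OF this] obtain \<beta>' where "\<forall>j. j \<le> r \<longrightarrow>
      col x j - (\<Sum>s<n. \<beta> j s *s tmap x (w s) + \<beta>' j s *s w s) \<in> S" ..
  then have \<beta>': "col x j - (\<Sum>s<n. \<beta> j s *s tmap x (w s) + \<beta>' j s *s w s) \<in> S" if "j \<le> r" for j
    using that by blast
  show ?thesis unfolding factors_def
    by (rule exI[of _ w], rule exI[of _ "\<lambda>s. tmap x (w s)"], rule exI[of _ "\<lambda>s j. \<beta> j s"],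
        rule exI[of _ "\<lambda>s j. \<beta>' j s"]) (use \<beta> \<beta>' in simp)
qed

section \<open>The tangent space as an orthogonal complement\<close>

text \<open>The minors used have the rows \<open>\<phi>\<close> and \<open>\<psi> s\<close>, and the
  columns \<open>e j\<close> and \<open>e (c s)\<close>, where the \<open>e (c s)\<close> span a
  complement of \<open>L \<inter> S\<close> in \<open>L\<close> and the \<open>\<psi> s\<close> are
  dual to them. Combining the minors over \<open>j\<close> with the coordinates of \<open>v\<close>
  leaves \<open>\<phi> (tmap x v)\<close> as the coefficient of eps.\<close>

lemma annihilator_tmap:
  assumes S: "subspace S" and dimS: "dim (L \<inter> S) + n = r + 1"
    and v: "v \<in> L \<inter> S" and \<phi>: "\<phi> \<in> annihilator scale S" and \<phi>L: "\<And>u. u \<in> L \<Longrightarrow> \<phi> u = 0"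
    and minors: "\<And>g. g \<in> chart_minors scale r e S (n + 1) \<Longrightarrow> lin_coeff V x g = 0"
  shows "\<phi> (tmap x v) = 0"
proof -
  obtain B0 where B0: "B0 \<subseteq> L \<inter> S" "independent B0" "L \<inter> S \<subseteq> span B0" "card B0 = dim (L \<inter> S)"
    using basis_exists[of "L \<inter> S"] by blast
  \<comment> \<open>Columns of minors are indexed by frame vectors, so the complement of
    \<open>L \<inter> S\<close> in \<open>L\<close> has to be spanned by members of the
    frame.\<close>
  obtain B where B: "B0 \<subseteq> B" "B \<subseteq> B0 \<union> e ` {..r}" "independent B" "B0 \<union> e ` {..r} \<subseteq> span B"
    using maximal_independent_subset_extend[OF Un_upper1 B0(2), of "e ` {..r}"] by blast
  have finB: "finite B" using B(3) finiteI_independent by blast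
  have "e ` {..r} \<subseteq> L" using frame_in_L by blast
  then have BL: "B \<subseteq> L" using B(2) B0(1) by blast
  have "L \<subseteq> span B"
    unfolding frame_basis(4)[symmetric] using B(4) by (intro span_minimal subspace_span) blast
  then have cB: "card B = r + 1" using basis_card_eq_dim[OF BL _ B(3)] dim_L by simp
  define C where "C = B - B0"
  have C: "C \<subseteq> e ` {..r}" "finite C" "independent C" "C \<subseteq> L"
    using B(2) finB independent_mono[OF B(3)] BL by (auto simp: C_def)
  have cC: "card C = n"
    using cB B0(4) dimS B(1) finite_subset[OF B(1) finB] by (simp add: C_def card_Diff_subset)
  obtain c0 where c0: "bij_betw c0 {..<n} C"
    using ex_bij_betw_nat_finite[OF C(2)] cC by (auto simp: atLeast0LessThan)
  have "\<forall>s. \<exists>j. s < n \<longrightarrow> j \<le> r \<and> e j = c0 s"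
    using C(1) bij_betwE[OF c0] by (metis atMost_iff imageE lessThan_iff subsetD)
  from choice[OF this] obtain c where c: "\<And>s. s < n \<Longrightarrow> c s \<le> r" "\<And>s. s < n \<Longrightarrow> e (c s) = c0 s"
    by blast
  have "span C \<inter> S \<subseteq> {0}"
  proof -
    have "span C \<subseteq> L" using C(4) subspace_L by (rule span_minimal)
    then have "span C \<inter> S \<subseteq> span B0 \<inter> span C" using B0(3) by blast
    also have "\<dots> \<subseteq> {0}"
      using B(1,3) C(2) finite_subset[OF B(1) finB]
      by (intro independent_Un_disjoint_span) (auto simp: C_def Un_absorb1)
    finally show ?thesis .
  qed
  then have "\<forall>s. \<exists>\<psi>. Vector_Spaces.linear scale (*) \<psi> \<and> (\<forall>x\<in>S. \<psi> x = 0) \<and>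
    (\<forall>x\<in>C. \<psi> x = (if x = c0 s then 1 else 0))"
    by (intro allI separating_functionals[OF S C(2,3)])
  from choice[OF this] obtain \<psi> where \<psi>: "\<And>s. Vector_Spaces.linear scale (*) (\<psi> s)"
    "\<And>s x. x \<in> S \<Longrightarrow> \<psi> s x = 0" "\<And>s x. x \<in> C \<Longrightarrow> \<psi> s x = (if x = c0 s then 1 else 0)"
    by blast
  have \<psi>c: "\<psi> s (e (c s')) = (if s = s' then 1 else 0)" if "s < n" "s' < n" for s s'
    using \<psi>(3)[of "c0 s'" s] c(2)[OF that(2)] bij_betwE[OF c0] that bij_betw_imp_inj_on[OF c0]
    by (auto simp: inj_on_def)
  define \<Phi> where "\<Phi> p = (case p of 0 \<Rightarrow> \<phi> | Suc s \<Rightarrow> \<psi> s)" for p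
  define cc where "cc j q = (case q of 0 \<Rightarrow> j | Suc s \<Rightarrow> c s)" for j q :: nat
  define M where "M j = mat (n + 1) (n + 1) (\<lambda>(p, q). Dual (\<Phi> p (e (cc j q))) (\<Phi> p (col x (cc j q))))" for j
  have \<Phi>: "\<Phi> p \<in> annihilator scale S" for p
    using \<phi> \<psi> by (auto simp: \<Phi>_def annihilator_def split: nat.split)
  then have lin: "Vector_Spaces.linear scale (*) (\<Phi> p)" and \<Phi>S: "u \<in> S \<Longrightarrow> \<Phi> p u = 0" for p u
    by (auto simp: annihilator_def)
  have cc: "cc j q \<le> r" if "j \<le> r" "q < n + 1" for j q
    using that c(1) by (auto simp: cc_def split: nat.split)
  have epsM: "eps (det (M j)) = 0" if "j \<le> r" for j
  proof -
    have "eval_dual V x (det (mat (n + 1) (n + 1) (\<lambda>(p, q). chart_entry d r e (\<Phi> p) (cc j q)))) = det (M j)"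
      unfolding M_def using \<Phi> cc[OF that] by (rule eval_dual_minor)
    moreover have "det (mat (n + 1) (n + 1) (\<lambda>(p, q). chart_entry d r e (\<Phi> p) (cc j q)))
        \<in> chart_minors scale r e S (n + 1)"
      unfolding chart_minors_def d_def using \<Phi> cc[OF that] by blast
    ultimately show ?thesis using minors by (metis dual.sel(2) eval_dual_def)
  qed
  \<comment> \<open>\<open>j\<close> enters \<open>M j\<close> only through column 0, so the
    cofactors along this column are the same for all \<open>j\<close>.\<close>
  define cof where "cof p = cofactor (M 0) p 0" for p
  have cof: "cofactor (M j) p 0 = cof p" if "p < n + 1" for j p
  proof -
    have "mat_delete (M j) p 0 = mat_delete (M 0) p 0"
      using that by (intro eq_matI) (auto simp: mat_delete_def M_def cc_def)
    then show ?thesis by (simp add: cof_def cofactor_def)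
  qed
  have detM: "det (M j) = (\<Sum>p<n + 1. Dual (\<Phi> p (e j)) (\<Phi> p (col x j)) * cof p)" for j
  proof -
    have "det (M j) = (\<Sum>p<n + 1. M j $$ (p, 0) * cofactor (M j) p 0)"
      by (rule laplace_expansion_column) (simp_all add: M_def)
    also have "\<dots> = (\<Sum>p<n + 1. Dual (\<Phi> p (e j)) (\<Phi> p (col x j)) * cof p)"
      using cof by (intro sum.cong refl) (simp add: M_def cc_def)
    finally show ?thesis .
  qed
  \<comment> \<open>At the origin the rows \<open>\<psi> s\<close> form the identity matrix on the
    columns \<open>c\<close>, and the row \<open>\<phi>\<close> is 0 on \<open>L\<close>. Hence only
    the cofactor belonging to the row \<open>\<phi>\<close> has a nonzero real part.\<close>
  have recof: "re (cof p) = (if p = 0 then 1 else 0)" if p: "p < n + 1" for p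
  proof -
    interpret h: comm_ring_hom "re :: 'k dual \<Rightarrow> 'k" by (rule comm_ring_hom_re)
    let ?D = "map_mat re (mat_delete (M 0) p 0)"
    have D: "?D = mat n n (\<lambda>(i, j). \<Phi> (if i < p then i else Suc i) (e (c j)))"
      by (intro eq_matI) (auto simp: mat_delete_def M_def cc_def)
    have detD: "re (det (mat_delete (M 0) p 0)) = det ?D" by (simp add: h.hom_det)
    show ?thesis
    proof (cases "p = 0")
      case True
      then have "?D = 1\<^sub>m n" unfolding D by (intro eq_matI) (auto simp: \<Phi>_def \<psi>c)
      then have "re (det (mat_delete (M 0) p 0)) = 1" unfolding detD by simp
      then show ?thesis using True by (simp add: cof_def cofactor_def)
    next
      case False
      then have "det ?D = 0"
        unfolding D using p \<phi>L frame_in_L c(1) by (intro det_zero_row[of _ n 0]) (auto simp: \<Phi>_def)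
      then have "re (det (mat_delete (M 0) p 0)) = 0" unfolding detD .
      then show ?thesis using False by (simp add: cof_def cofactor_def)
    qed
  qed
  \<comment> \<open>The combination turns column 0 into the values of the rows at \<open>v\<close> +
    eps \<open>tmap x v\<close>. All rows vanish at \<open>v\<close>, which lies in
    \<open>S\<close>, so only the real parts of the cofactors count.\<close>
  have "(\<Sum>j\<le>r. Dual (coord j v) 0 * det (M j)) =
      (\<Sum>p<n + 1. (\<Sum>j\<le>r. Dual (coord j v) 0 * Dual (\<Phi> p (e j)) (\<Phi> p (col x j))) * cof p)"
    unfolding detM sum_distrib_left sum_distrib_right by (subst sum.swap) (simp add: mult.assoc)
  also have "\<dots> = (\<Sum>p<n + 1. Dual 0 (\<Phi> p (tmap x v)) * cof p)"
  proof (intro sum.cong refl arg_cong2[of _ _ _ _ "(*)"])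
    fix p
    have "(\<Sum>j\<le>r. coord j v * \<Phi> p (e j)) = \<Phi> p (\<Sum>j\<le>r. coord j v *s e j)"
      by (rule linear_functional_sum[OF lin, symmetric])
    also have "\<dots> = 0" using v \<Phi>S by (simp add: coord_sum_L)
    finally show "(\<Sum>j\<le>r. Dual (coord j v) 0 * Dual (\<Phi> p (e j)) (\<Phi> p (col x j))) = Dual 0 (\<Phi> p (tmap x v))"
      unfolding tmap_def linear_functional_sum[OF lin] by (intro dual.expand) simp
  qed
  finally have "eps (\<Sum>j\<le>r. Dual (coord j v) 0 * det (M j)) = (\<Sum>p<n + 1. \<Phi> p (tmap x v) * re (cof p))"
    by simp
  moreover have "eps (\<Sum>j\<le>r. Dual (coord j v) 0 * det (M j)) = 0"
    using epsM by simp
  moreover have "(\<Sum>p<n + 1. \<Phi> p (tmap x v) * re (cof p)) = (\<Sum>p<n + 1. if p = 0 then \<phi> (tmap x v) else 0)"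
    using recof by (intro sum.cong) (auto simp: \<Phi>_def)
  ultimately show ?thesis by (simp split: if_splits)
qed

definition outer :: "('v \<Rightarrow> 'k) \<Rightarrow> 'v \<Rightarrow> nat \<times> nat \<Rightarrow> 'k" where
  "outer \<phi> v z = (if z \<in> V then \<phi> (e (fst z)) * coord (snd z) v else 0)"

lemma outer_supported: "outer \<phi> v \<in> supported V"
  by (simp add: outer_def supported_def)

lemma sum_V: "(\<Sum>z\<in>V. f z) = (\<Sum>j\<le>r. \<Sum>l = r + 1..<d. f (l, j) :: 'c::comm_monoid_add)"
  unfolding chart_vars_def by (subst sum.swap) (simp add: sum.cartesian_product)

text \<open>The trace of a composite with a rank-one map is a single evaluation.\<close>

lemma pairing_outer:
  assumes "Vector_Spaces.linear scale (*) \<phi>"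
  shows "pairing V x (outer \<phi> v) = \<phi> (tmap x v)"
proof -
  have "pairing V x (outer \<phi> v) = (\<Sum>j\<le>r. \<Sum>l = r + 1..<d. x (l, j) * (\<phi> (e l) * coord j v))"
    unfolding pairing_def sum_V by (intro sum.cong refl) (simp add: outer_def chart_vars_def)
  also have "\<dots> = (\<Sum>j\<le>r. coord j v * (\<Sum>l = r + 1..<d. x (l, j) * \<phi> (e l)))"
    unfolding sum_distrib_left by (intro sum.cong refl) (simp add: mult_ac)
  also have "\<dots> = \<phi> (tmap x v)"
    unfolding tmap_def col_def linear_functional_sum[OF assms] by simp
  finally show ?thesis .
qed

text \<open>The rank-one elements of the conormal space of a Schubert variety at \<open>L\<close>; via the trace
  pairing, \<open>outer \<phi> v\<close> is the map \<open>h \<mapsto> \<phi> h *s v\<close> in \<open>Hom(H / L, L)\<close>.\<close>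

definition conormal :: "(nat \<Rightarrow> 'v set) \<Rightarrow> (nat \<Rightarrow> nat) \<Rightarrow> (nat \<times> nat \<Rightarrow> 'k) set" where
  "conormal P a = {outer \<phi> v | i \<phi> v. active r a i \<and> v \<in> L \<inter> P (a i) \<and>
     \<phi> \<in> annihilator scale (P (a i)) \<and> \<phi> \<in> annihilator scale L}"

section \<open>Schubert conditions along a flag, to first order\<close>

lemma flagD:
  assumes "complete_flag scale P"
  shows "i \<le> d \<Longrightarrow> subspace (P i)" "i \<le> d \<Longrightarrow> dim (P i) = d - i"
    "i < d \<Longrightarrow> P (Suc i) \<subseteq> P i"
  using assms unfolding complete_flag_def Let_def d_def[symmetric] by blast+

lemma flag_antimono:
  assumes "complete_flag scale P" "i \<le> j" "j \<le> d"
  shows "P j \<subseteq> P i"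
  using assms(2,3)
proof (induction j rule: dec_induct)
  case (step j)
  then show ?case using flagD(3)[OF assms(1), of j] by simp
qed simp

lemma flag_0:
  assumes "complete_flag scale P" shows "P 0 = UNIV"
proof -
  have "dim (P 0) = d" "subspace (P 0)" using flagD[OF assms, of 0] by simp_all
  then show ?thesis using subspace_dim_equal[of "P 0" UNIV] unfolding d_def by simp
qed

context
  fixes P :: "nat \<Rightarrow> 'v set" and a :: "nat \<Rightarrow> nat"
  assumes flag: "complete_flag scale P" and a: "strict_mono_on {..r} a" "a r < d"
    and open_point: "L \<in> schubert_open_points scale r P a"
begin

lemma index_less: "i \<le> r \<Longrightarrow> a i < d"
  using a strict_mono_on_leD[OF a(1), of i r] by simp

lemma dim_active: "active r a i \<Longrightarrow> dim (L \<inter> P (a i)) + i = r + 1"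
  using open_point unfolding schubert_open_points_def by (auto simp: active_def)

text \<open>At an inactive index \<open>i > 0\<close> the entry grows by exactly 1, so both the
  codimension and the admissible rank go up by 1 and \<open>factors_subspace\<close> passes the
  factorization on. If 0 is inactive, then \<open>P (a 0)\<close> is all of H and the admissible
  rank is 0.\<close>

lemma factors_all:
  assumes act: "\<And>i v. active r a i \<Longrightarrow> v \<in> L \<inter> P (a i) \<Longrightarrow> tmap x v \<in> {s + l | s l. s \<in> P (a i) \<and> l \<in> L}"
    and "i \<le> r"
  shows "factors x (P (a i)) i"
  using assms(2)
proof (induction i)
  case 0
  show ?case
  proof (cases "active r a 0")
    case True
    then show ?thesis
      using flagD(1)[OF flag] index_less[of 0] dim_active[of 0] act[OF True] by (intro factors_if_tmap) auto
  next
    case False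
    then have "a 0 = 0" by (simp add: active_def)
    then show ?thesis using factors_UNIV flag_0[OF flag] by simp
  qed
next
  case (Suc i)
  show ?case
  proof (cases "active r a (Suc i)")
    case True
    then show ?thesis
      using flagD(1)[OF flag] index_less[OF Suc.prems] dim_active[OF True] act[OF True]
      by (intro factors_if_tmap) auto
  next
    case False
    have "a i < a (Suc i)" using a(1) Suc.prems by (auto simp: strict_mono_on_def)
    then have eq: "a (Suc i) = Suc (a i)" using False Suc.prems by (simp add: active_def)
    have lt: "Suc (a i) < d" using index_less[OF Suc.prems] eq by simp
    have "factors x (P (a (Suc i))) (i + (dim (P (a i)) - dim (P (a (Suc i)))))"
      using Suc lt flagD[OF flag] unfolding eq by (intro factors_subspace) auto
    then show ?thesis using flagD(2)[OF flag] lt unfolding eq by simp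
  qed
qed

text \<open>The zero direction trivially satisfies the conditions of \<open>factors_all\<close>; the
  constant terms of the minors are thus 0, which says that \<open>L\<close> lies on the
  scheme.\<close>

lemma chart_minors_origin_ideal: "(\<Union>i\<le>r. chart_minors scale r e (P (a i)) (i + 1)) \<subseteq> origin_ideal V"
proof clarify
  fix i g assume i: "i \<le> r" and g: "g \<in> chart_minors scale r e (P (a i)) (i + 1)"
  have "tmap (\<lambda>_. 0) v = 0" for v by (simp add: tmap_def col_def)
  moreover have "\<exists>s l. 0 = s + l \<and> s \<in> P (a i) \<and> l \<in> L" if "active r a i" for i
    using that index_less[of i] subspace_0[OF subspace_L] subspace_0[OF flagD(1)[OF flag, of "a i"]]
    by (intro exI[of _ 0]) (simp add: active_def)
  ultimately have "factors (\<lambda>_. 0) (P (a i)) i" using i by (intro factors_all) auto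
  from eval_dual_chart_minor_factors[OF this g] have "Poly_Mapping.lookup g 0 = 0"
    by (metis dual.sel(1) dual_sel(1) eval_dual_def)
  then show "g \<in> origin_ideal V" using chart_minors_polys[OF g] by (simp add: origin_ideal_def)
qed

text \<open>From left to right this is \<open>annihilator_tmap\<close> at each active index.
  Conversely, a vector \<open>tmap x v\<close> outside \<open>P (a i) + L\<close> would be detected
  by a functional that yields an element of \<open>conormal P a\<close>; so
  \<open>factors_all\<close> applies.\<close>

lemma lin_coeff_minors_iff:
  "(\<forall>g \<in> (\<Union>i\<le>r. chart_minors scale r e (P (a i)) (i + 1)). lin_coeff V x g = 0) \<longleftrightarrow>
   (\<forall>y\<in>conormal P a. pairing V x y = 0)"
proof
  assume *: "\<forall>g \<in> (\<Union>i\<le>r. chart_minors scale r e (P (a i)) (i + 1)). lin_coeff V x g = 0"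
  show "\<forall>y\<in>conormal P a. pairing V x y = 0"
  proof
    fix y assume "y \<in> conormal P a"
    then obtain i \<phi> v where y: "y = outer \<phi> v" and i: "active r a i" and v: "v \<in> L \<inter> P (a i)"
      and \<phi>: "\<phi> \<in> annihilator scale (P (a i))" and \<phi>L: "\<phi> \<in> annihilator scale L"
      unfolding conormal_def by blast
    have ir: "i \<le> r" using i by (simp add: active_def)
    have "\<phi> (tmap x v) = 0"
    proof (rule annihilator_tmap[OF _ dim_active[OF i] v \<phi>])
      show "subspace (P (a i))" using flagD(1)[OF flag] index_less[OF ir] by simp
      show "\<phi> u = 0" if "u \<in> L" for u using \<phi>L that by (simp add: annihilator_def)
      show "lin_coeff V x g = 0" if "g \<in> chart_minors scale r e (P (a i)) (i + 1)" for g
        using * ir that by blast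
    qed
    then show "pairing V x y = 0" unfolding y using \<phi> by (simp add: pairing_outer annihilator_def)
  qed
next
  assume *: "\<forall>y\<in>conormal P a. pairing V x y = 0"
  have "tmap x v \<in> {s + l | s l. s \<in> P (a i) \<and> l \<in> L}" if i: "active r a i" and v: "v \<in> L \<inter> P (a i)" for i v
  proof (rule ccontr)
    assume no: "tmap x v \<notin> {s + l | s l. s \<in> P (a i) \<and> l \<in> L}"
    have ir: "i \<le> r" using i by (simp add: active_def)
    have sP: "subspace (P (a i))" using flagD(1)[OF flag] index_less[OF ir] by simp
    obtain \<phi> where \<phi>: "Vector_Spaces.linear scale (*) \<phi>"
      "\<forall>u\<in>{s + l | s l. s \<in> P (a i) \<and> l \<in> L}. \<phi> u = 0" "\<phi> (tmap x v) = 1"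
      using separating_functional[OF subspace_sums[OF sP subspace_L] no] by blast
    have "\<phi> u = 0" if "u \<in> P (a i)" for u
    proof -
      have "u = u + 0" "0 \<in> L" using subspace_0[OF subspace_L] by simp_all
      then show ?thesis using \<phi>(2) that by blast
    qed
    moreover have "\<phi> u = 0" if "u \<in> L" for u
    proof -
      have "u = 0 + u" "0 \<in> P (a i)" using subspace_0[OF sP] by simp_all
      then show ?thesis using \<phi>(2) that by blast
    qed
    ultimately have "outer \<phi> v \<in> conormal P a"
      unfolding conormal_def annihilator_def using i v \<phi>(1) by blast
    then have "pairing V x (outer \<phi> v) = 0" using * by blast
    then show False using pairing_outer[OF \<phi>(1)] \<phi>(3) by simp
  qed
  note factors = factors_all[OF this]
  show "\<forall>g \<in> (\<Union>i\<le>r. chart_minors scale r e (P (a i)) (i + 1)). lin_coeff V x g = 0"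
  proof clarify
    fix i g assume "i \<le> r" "g \<in> chart_minors scale r e (P (a i)) (i + 1)"
    then have "eval_dual V x g = 0" using eval_dual_chart_minor_factors[OF factors] by blast
    then show "lin_coeff V x g = 0" by (metis dual.sel(2) dual_sel(2) eval_dual_def)
  qed
qed

end

end

section \<open>Dimension of the conormal spaces\<close>

lemma strict_mono_on_add_le:
  fixes a :: "nat \<Rightarrow> nat"
  assumes "strict_mono_on {..r} a" "i \<le> k" "k \<le> r"
  shows "a i + (k - i) \<le> a k"
  using assms(2,3)
proof (induction k rule: dec_induct)
  case (step k)
  have "a k < a (Suc k)" using assms(1) step.prems by (auto simp: strict_mono_on_def)
  then show ?case using step by simp
qed simp

lemma strict_mono_on_le:
  fixes a :: "nat \<Rightarrow> nat"
  assumes "strict_mono_on {..r} a" "k \<le> r"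
  shows "k \<le> a k"
  using strict_mono_on_add_le[OF assms(1), of 0 k] assms(2) by simp

text \<open>The excess \<open>a k - k\<close> starts at 0 unless index 0 is active, and is unchanged
  by inactive steps.\<close>

lemma excess_active:
  assumes "strict_mono_on {..r} a" "k \<le> r"
  shows "a k - k = 0 \<or> (\<exists>i\<le>k. active r a i \<and> a i - i = a k - k)"
  using assms(2)
proof (induction k)
  case 0
  then show ?case by (auto simp: active_def)
next
  case (Suc k)
  show ?case
  proof (cases "active r a (Suc k)")
    case False
    have "a k < a (Suc k)" using assms(1) Suc.prems by (auto simp: strict_mono_on_def)
    then have "a (Suc k) = Suc (a k)" using False Suc.prems by (simp add: active_def)
    then show ?thesis using Suc by (auto intro: le_SucI)
  qed auto
qed

context adapted_chart
begin

text \<open>The intersections L \<inter> P c followed by the sums L + P c form a single increasing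
  chain, so one basis is adapted to all of them.\<close>

lemma adapted_basis:
  assumes P: "complete_flag scale P"
  shows "\<exists>w. inj_on w {..<d} \<and> independent (w ` {..<d}) \<and> span (w ` {..<d}) = UNIV \<and>
    (\<forall>c\<le>d. span (w ` {..<dim (L \<inter> P c)}) = L \<inter> P c) \<and>
    (\<forall>c\<le>d. span (w ` {..<dim {x + y | x y. x \<in> L \<and> y \<in> P c}}) = {x + y | x y. x \<in> L \<and> y \<in> P c})"
proof -
  \<comment> \<open>Indices up to \<open>d\<close> run from L \<inter> P d to L \<inter> P 0 = L;
    indices from \<open>d + 1\<close> to \<open>2 * d + 1\<close> run from L + P d to L + P 0 =
    H.\<close>
  define S where "S k = (if k \<le> d then L \<inter> P (d - k) else {x + y | x y. x \<in> L \<and> y \<in> P (2 * d + 1 - k)})" for k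
  have sP: "subspace (P c)" if "c \<le> d" for c by (rule flagD(1)[OF P that])
  have sub: "subspace (S k)" for k
    by (simp add: S_def subspace_inter subspace_sums subspace_L sP)
  have "mono S"
  proof (rule monoI)
    fix k k' :: nat assume le: "k \<le> k'"
    consider "k' \<le> d" | "k \<le> d" "d < k'" | "d < k" by linarith
    then show "S k \<subseteq> S k'"
    proof cases
      case 1
      have "P (d - k) \<subseteq> P (d - k')" using le by (intro flag_antimono[OF P]) auto
      then show ?thesis using le 1 by (auto simp: S_def)
    next
      case 2
      have "0 \<in> P (2 * d + 1 - k')" using 2 by (intro subspace_0 sP) simp
      then have "x \<in> {x + y | x y. x \<in> L \<and> y \<in> P (2 * d + 1 - k')}" if "x \<in> L" for x
        using that by (intro CollectI exI[of _ x] exI[of _ 0]) simp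
      then show ?thesis using 2 by (auto simp: S_def)
    next
      case 3
      have "P (2 * d + 1 - k) \<subseteq> P (2 * d + 1 - k')" using le 3 by (intro flag_antimono[OF P]) auto
      then show ?thesis using le 3 by (auto simp: S_def)
    qed
  qed
  from adapted_basis_chain[OF sub this, of "2 * d + 1"]
  obtain w where w: "inj_on w {..<dim (S (2 * d + 1))}" "independent (w ` {..<dim (S (2 * d + 1))})"
    "\<And>k. k \<le> 2 * d + 1 \<Longrightarrow> span (w ` {..<dim (S k)}) = S k" by blast
  have "x \<in> S (2 * d + 1)" for x
  proof -
    have "x = 0 + x" "0 \<in> L" "x \<in> P 0" using subspace_0[OF subspace_L] flag_0[OF P] by simp_all
    then have "x \<in> {x + y | x y. x \<in> L \<and> y \<in> P 0}" by blast
    then show ?thesis by (simp add: S_def)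
  qed
  then have S_UNIV: "S (2 * d + 1) = UNIV" by blast
  have "span (w ` {..<dim (L \<inter> P c)}) = L \<inter> P c" if "c \<le> d" for c
    using w(3)[of "d - c"] that by (simp add: S_def)
  moreover have "span (w ` {..<dim {x + y | x y. x \<in> L \<and> y \<in> P c}}) = {x + y | x y. x \<in> L \<and> y \<in> P c}"
    if "c \<le> d" for c
  proof -
    have "\<not> 2 * d + 1 - c \<le> d" "2 * d + 1 - (2 * d + 1 - c) = c" using that by simp_all
    then have "S (2 * d + 1 - c) = {x + y | x y. x \<in> L \<and> y \<in> P c}" by (simp only: S_def if_False)
    then show ?thesis using w(3)[of "2 * d + 1 - c"] by simp
  qed
  ultimately show ?thesis
    using w(1,2) w(3)[of "2 * d + 1"] unfolding S_UNIV d_def[symmetric] by (intro exI[of _ w]) simp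
qed

section \<open>Conormal vectors as endomorphisms of H\<close>

definition endo :: "(nat \<times> nat \<Rightarrow> 'k) \<Rightarrow> 'v \<Rightarrow> 'v" where
  "endo y h = (\<Sum>z\<in>V. (y z * coord (fst z) h) *s e (snd z))"

lemma endo_add_left: "endo (y + y') h = endo y h + endo y' h"
  by (simp add: endo_def distrib_right scale_left_distrib sum.distrib)

lemma endo_scale_left: "endo (fscale c y) h = c *s endo y h"
  by (simp add: endo_def scale_sum_right mult.assoc)

lemma fst_V: "z \<in> V \<Longrightarrow> fst z < d" and snd_V: "z \<in> V \<Longrightarrow> snd z \<le> r"
  by (auto simp: chart_vars_def)

lemma endo_add: "endo y (h + h') = endo y h + endo y h'"
  unfolding endo_def sum.distrib[symmetric]
  by (intro sum.cong refl) (simp add: coord_add fst_V distrib_left scale_left_distrib)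

lemma endo_scale: "endo y (c *s h) = c *s endo y h"
  unfolding endo_def scale_sum_right
  by (intro sum.cong refl) (simp add: coord_scale fst_V mult.left_commute)

lemma endo_in_L: "endo y h \<in> L"
  unfolding endo_def using snd_V by (intro subspace_sum subspace_scale subspace_L frame_in_L) simp

lemma endo_zero_on_L:
  assumes "u \<in> L" shows "endo y u = 0"
  unfolding endo_def
proof (rule sum.neutral, rule ballI)
  fix z assume "z \<in> V"
  then have "coord (fst z) u = 0" using coord_L[OF assms] by (auto simp: chart_vars_def)
  then show "(y z * coord (fst z) u) *s e (snd z) = 0" by simp
qed

lemma endo_outer:
  assumes \<phi>: "\<phi> \<in> annihilator scale L" and v: "v \<in> L"
  shows "endo (outer \<phi> v) h = \<phi> h *s v"
proof -
  have lin: "Vector_Spaces.linear scale (*) \<phi>" and \<phi>L: "\<And>u. u \<in> L \<Longrightarrow> \<phi> u = 0"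
    using \<phi> by (auto simp: annihilator_def)
  have "\<phi> h = (\<Sum>m<d. coord m h * \<phi> (e m))"
    using linear_functional_sum[OF lin, of "\<lambda>m. coord m h" e "{..<d}"] by (simp add: coord_sum)
  also have "\<dots> = (\<Sum>l = r + 1..<d. coord l h * \<phi> (e l))"
    using \<phi>L frame_in_L r_less by (intro sum.mono_neutral_right) auto
  finally have \<phi>h: "(\<Sum>l = r + 1..<d. coord l h * \<phi> (e l)) = \<phi> h" ..
  have "endo (outer \<phi> v) h = (\<Sum>j\<le>r. \<Sum>l = r + 1..<d. (\<phi> (e l) * coord j v * coord l h) *s e j)"
    unfolding endo_def sum_V by (intro sum.cong refl) (simp add: outer_def chart_vars_def)
  also have "\<dots> = (\<Sum>j\<le>r. ((\<Sum>l = r + 1..<d. coord l h * \<phi> (e l)) * coord j v) *s e j)"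
    unfolding sum_distrib_right scale_sum_left by (intro sum.cong refl) (simp add: mult_ac)
  also have "\<dots> = \<phi> h *s (\<Sum>j\<le>r. coord j v *s e j)"
    unfolding \<phi>h by (simp add: scale_sum_right)
  finally show ?thesis using coord_sum_L[OF v] by simp
qed

lemma endo_inj:
  assumes y: "y \<in> supported V" and zero: "\<And>h. endo y h = 0"
  shows "y = 0"
proof
  fix z
  show "y z = 0 z"
  proof (cases "z \<in> V")
    case True
    then obtain l j where z: "z = (l, j)" "r < l" "l < d" "j \<le> r" by (auto simp: chart_vars_def)
    have "endo y (e l) = (\<Sum>j\<le>r. \<Sum>l' = r + 1..<d. if l' = l then y (l, j) *s e j else 0)"
      unfolding endo_def sum_V using z(3) by (intro sum.cong refl) (auto simp: coord_frame)
    also have "\<dots> = (\<Sum>j\<le>r. y (l, j) *s e j)" using z(2,3) by simp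
    finally have "(\<Sum>j\<le>r. y (l, j) *s e j) = 0" using zero by simp
    then have "coord j (\<Sum>i\<le>r. y (l, i) *s e i) = coord j (0 *s 0)" by simp
    moreover have "coord j (\<Sum>i\<le>r. y (l, i) *s e i) = (\<Sum>i\<le>r. y (l, i) * coord j (e i))"
      using z(4) r_less by (intro linear_functional_sum linear_coord) simp
    moreover have "\<dots> = (\<Sum>i\<le>r. if i = j then y (l, i) else 0)"
      using z(4) r_less by (intro sum.cong refl) (auto simp: coord_frame)
    moreover have "coord j (0 *s 0) = 0" using coord_scale[of j 0 0] z(4) r_less by simp
    ultimately show ?thesis using z(1,4) by simp
  next
    case False
    have "\<forall>z. z \<notin> V \<longrightarrow> y z = 0" using y unfolding supported_def by (rule CollectD)
    with False show ?thesis by (metis zero_fun_apply)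
  qed
qed

lemma conormal_supported: "fun_space.span (conormal P a) \<subseteq> supported V"
  by (intro fun_space.span_minimal subspace_supported) (auto simp: conormal_def outer_supported)

text \<open>It suffices to consider h \<mapsto> \<open>\<phi> h *s v\<close> at an active index. If
  \<open>a i \<le> c\<close>, then \<open>\<phi>\<close> vanishes on \<open>P c\<close>; if
  \<open>c' \<le> a i\<close>, then \<open>v\<close> lies in \<open>P c'\<close>. For
  \<open>c' = c + 1\<close> one of the two always holds; a longer step must jump over no active
  entry.\<close>

lemma endo_step:
  assumes P: "complete_flag scale P" and ad: "\<And>i. active r a i \<Longrightarrow> a i \<le> d"
    and c: "c \<le> d" "c' \<le> d"
    and step: "\<And>i. active r a i \<Longrightarrow> a i \<le> c \<or> c' \<le> a i"
    and y: "y \<in> fun_space.span (conormal P a)" and h: "h \<in> P c"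
  shows "endo y h \<in> P c'"
proof -
  have sP: "subspace (P c')" by (rule flagD(1)[OF P c(2)])
  have "fun_space.subspace {y. endo y h \<in> P c'}"
  proof (rule fun_space.subspaceI)
    have "endo 0 h = 0" by (simp add: endo_def)
    then show "0 \<in> {y. endo y h \<in> P c'}" using subspace_0[OF sP] by simp
  qed (use sP in \<open>auto simp: endo_add_left endo_scale_left intro: subspace_add subspace_scale\<close>)
  moreover have "conormal P a \<subseteq> {y. endo y h \<in> P c'}"
  proof
    fix y assume "y \<in> conormal P a"
    then obtain i \<phi> v where y: "y = outer \<phi> v" and i: "active r a i" and v: "v \<in> L" "v \<in> P (a i)"
      and \<phi>: "\<phi> \<in> annihilator scale (P (a i))" "\<phi> \<in> annihilator scale L"
      unfolding conormal_def by blast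
    have endo: "endo y h = \<phi> h *s v" unfolding y by (rule endo_outer[OF \<phi>(2) v(1)])
    have "endo y h \<in> P c'"
    proof (cases "a i \<le> c")
      case True
      then have "h \<in> P (a i)" using flag_antimono[OF P True c(1)] h by blast
      then have "\<phi> h = 0" using \<phi>(1) by (simp add: annihilator_def)
      then show ?thesis unfolding endo using subspace_0[OF sP] by simp
    next
      case False
      then have "c' \<le> a i" using step[OF i] by simp
      then have "v \<in> P c'" using flag_antimono[OF P _ ad[OF i]] v(2) by blast
      then show ?thesis unfolding endo by (rule subspace_scale[OF sP])
    qed
    then show "y \<in> {y. endo y h \<in> P c'}" by simp
  qed
  ultimately show ?thesis using fun_space.span_minimal y by blast
qed

text \<open>In a basis adapted to all L \<inter> P c and L + P c, each active index contributes a
  full rectangle of products of a dual basis functional with a basis vector. These products are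
  independent, so the dimension is the size of the union of the rectangles, a staircase.\<close>

lemma dim_conormal:
  assumes P: "complete_flag scale P" and a: "strict_mono_on {..r} a" "a r < d"
    and open_point: "L \<in> schubert_open_points scale r P a"
  shows "fun_space.dim (fun_space.span (conormal P a)) = (\<Sum>i\<le>r. a i - i)"
proof -
  obtain w where w: "inj_on w {..<d}" "independent (w ` {..<d})" "span (w ` {..<d}) = UNIV"
    and wI: "\<And>c. c \<le> d \<Longrightarrow> span (w ` {..<dim (L \<inter> P c)}) = L \<inter> P c"
    and wS: "\<And>c. c \<le> d \<Longrightarrow> span (w ` {..<dim {x + y | x y. x \<in> L \<and> y \<in> P c}}) = {x + y | x y. x \<in> L \<and> y \<in> P c}"
    using adapted_basis[OF P] by blast
  have wL: "w l \<in> L" if "l \<le> r" for l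
  proof -
    have "span (w ` {..<r + 1}) = L" using wI[of 0] flag_0[OF P] dim_L by simp
    then show ?thesis using span_base[of "w l" "w ` {..<r + 1}"] that by auto
  qed
  from dual_basis[OF w]
  obtain f where f: "\<And>m. m < d \<Longrightarrow> Vector_Spaces.linear scale (*) (f m)"
    "\<And>m l. m < d \<Longrightarrow> l < d \<Longrightarrow> f m (w l) = (if m = l then 1 else 0)"
    "\<And>h. (\<Sum>m<d. f m h *s w m) = h" by blast
  have act: "i \<le> r" "a i \<le> d" "i \<le> a i" "dim (L \<inter> P (a i)) = r + 1 - i"
    "dim {x + y | x y. x \<in> L \<and> y \<in> P (a i)} = d - (a i - i)" if i: "active r a i" for i
  proof -
    show ir: "i \<le> r" using i by (simp add: active_def)
    show ad: "a i \<le> d" using index_less[OF P a open_point ir] by simp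
    show ia: "i \<le> a i" by (rule strict_mono_on_le[OF a(1) ir])
    show dI: "dim (L \<inter> P (a i)) = r + 1 - i" using dim_active[OF P a open_point i] by simp
    show "dim {x + y | x y. x \<in> L \<and> y \<in> P (a i)} = d - (a i - i)"
      using dim_sums_Int[OF subspace_L flagD(1)[OF P ad]] dim_L flagD(2)[OF P ad] dI ir ad ia by simp
  qed
  have wP: "w l \<in> L \<inter> P (a i)" if "active r a i" "l < r + 1 - i" for i l
    using wI[OF act(2)[OF that(1)]] act(4)[OF that(1)] span_base[of "w l" "w ` {..<r + 1 - i}"] that(2) by auto
  have wPL: "span (w ` {..<d - (a i - i)}) = {x + y | x y. x \<in> L \<and> y \<in> P (a i)}" if "active r a i" for i
    using wS[OF act(2)[OF that]] act(5)[OF that] by simp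
  have sumL: "u \<in> {x + y | x y. x \<in> L \<and> y \<in> P (a i)}" if "active r a i" "u \<in> L" for i u
    using that subspace_0[OF flagD(1)[OF P act(2)[OF that(1)]]] by (intro CollectI exI[of _ u] exI[of _ 0]) simp
  have sumP: "u \<in> {x + y | x y. x \<in> L \<and> y \<in> P (a i)}" if "u \<in> P (a i)" for i u
    using that subspace_0[OF subspace_L] by (intro CollectI exI[of _ 0] exI[of _ u]) simp
  have f_zero: "f m u = 0" if "active r a i" "d - (a i - i) \<le> m" "m < d" "u \<in> {x + y | x y. x \<in> L \<and> y \<in> P (a i)}"
    for i m u
    by (rule functional_zero_on_span[OF f(1)[OF that(3)], of "w ` {..<d - (a i - i)}"])
      (use that f(2) wPL[OF that(1)] in auto)
  have f_ann: "f m \<in> annihilator scale (P (a i))" "f m \<in> annihilator scale L"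
    if "active r a i" "d - (a i - i) \<le> m" "m < d" for i m
    using f_zero[OF that] f(1)[OF that(3)] sumP sumL[OF that(1)] by (simp_all add: annihilator_def)
  \<comment> \<open>The rectangle of \<open>i\<close>: the \<open>w l\<close> with
    \<open>l < r + 1 - i\<close> span L \<inter> P (a i), and the \<open>f m\<close> with
    \<open>m \<ge> d - (a i - i)\<close> are those that vanish on L + P (a i), a space of dimension
    \<open>d - (a i - i)\<close>.\<close>
  define J where "J = {(m, l). \<exists>i. active r a i \<and> l < r + 1 - i \<and> d - (a i - i) \<le> m \<and> m < d}"
  define Y where "Y z = outer (f (fst z)) (w (snd z))" for z
  have J_less: "m < d" "l \<le> r" "l < d" if "(m, l) \<in> J" for m l
    using that r_less by (auto simp: J_def)
  have "J \<subseteq> {..<d} \<times> {..<d}" using J_less by auto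
  then have finJ: "finite J" by (rule finite_subset) simp
  \<comment> \<open>The l-th coordinate of the image of \<open>w m\<close> is the functional dual to
    \<open>Y (m, l)\<close>.\<close>
  have endoY: "f l (endo (Y (m', l')) (w m)) = (if (m, l) = (m', l') then 1 else 0)"
    if "(m, l) \<in> J" "(m', l') \<in> J" for m l m' l'
  proof -
    have "f m' \<in> annihilator scale L" using that(2) f_ann(2) by (auto simp: J_def)
    then have "endo (Y (m', l')) (w m) = f m' (w m) *s w l'"
      unfolding Y_def fst_conv snd_conv using wL[OF J_less(2)[OF that(2)]] by (rule endo_outer)
    then have "f l (endo (Y (m', l')) (w m)) = f m' (w m) * f l (w l')"
      using f(1)[OF J_less(3)[OF that(1)]] by (simp add: linear_functional_iff)
    then show ?thesis using f(2) J_less[OF that(1)] J_less[OF that(2)] by simp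
  qed
  have lin: "Vector_Spaces.linear fscale (*) (\<lambda>y. f (snd z) (endo y (w (fst z))))" if "z \<in> J" for z
  proof -
    have "Vector_Spaces.linear scale (*) (f (snd z))" using f(1) J_less(3)[of "fst z" "snd z"] that by simp
    then show ?thesis
      unfolding fun_space.linear_functional_iff linear_functional_iff
      by (simp add: endo_add_left endo_scale_left)
  qed
  have dualY: "f (snd z) (endo (Y z') (w (fst z))) = (if z = z' then 1 else 0)" if "z \<in> J" "z' \<in> J" for z z'
    using endoY[of "fst z" "snd z" "fst z'" "snd z'"] that by simp
  have ind: "inj_on Y J" "fun_space.independent (Y ` J)"
    by (rule fun_space.independent_if_dual[OF finJ lin dualY]; assumption)+
  have YJ: "Y ` J \<subseteq> conormal P a"
  proof
    fix y assume "y \<in> Y ` J"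
    then obtain m l where ml: "(m, l) \<in> J" "y = outer (f m) (w l)" by (auto simp: Y_def)
    then obtain i where "active r a i" "l < r + 1 - i" "d - (a i - i) \<le> m" "m < d" by (auto simp: J_def)
    then show "y \<in> conormal P a" unfolding conormal_def ml(2) using wP f_ann by blast
  qed
  have "conormal P a \<subseteq> fun_space.span (Y ` J)"
  proof
    fix y assume "y \<in> conormal P a"
    then obtain i \<phi> v where y: "y = outer \<phi> v" and i: "active r a i" and v: "v \<in> L \<inter> P (a i)"
      and \<phi>: "\<phi> \<in> annihilator scale (P (a i))" "\<phi> \<in> annihilator scale L"
      unfolding conormal_def by blast
    let ?A = "{d - (a i - i)..<d}" and ?B = "{..<r + 1 - i}"
    have lin\<phi>: "Vector_Spaces.linear scale (*) \<phi>" using \<phi> by (simp add: annihilator_def)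
    have \<phi>w: "\<phi> (w m) = 0" if "m < d - (a i - i)" for m
    proof -
      have "w m \<in> {x + y | x y. x \<in> L \<and> y \<in> P (a i)}"
        unfolding wPL[OF i, symmetric] using that by (intro span_base) simp
      then show ?thesis using \<phi> lin\<phi> by (auto simp: annihilator_def linear_functional_iff)
    qed
    have \<phi>_expand: "\<phi> h = (\<Sum>m\<in>?A. f m h * \<phi> (w m))" for h
    proof -
      have "\<phi> h = (\<Sum>m<d. f m h * \<phi> (w m))"
        using linear_functional_sum[OF lin\<phi>, of "\<lambda>m. f m h" w "{..<d}"] by (simp add: f(3))
      also have "\<dots> = (\<Sum>m\<in>?A. f m h * \<phi> (w m))"
        using \<phi>w by (intro sum.mono_neutral_right) auto
      finally show ?thesis .
    qed
    have fv: "f l v = 0" if "l < d" "r + 1 - i \<le> l" for l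
      by (rule functional_zero_on_span[OF f(1)[OF that(1)], of "w ` ?B"])
        (use that f(2) v wI[OF act(2)[OF i]] act(4)[OF i] in auto)
    have "v = (\<Sum>l<d. f l v *s w l)" by (rule f(3)[symmetric])
    also have "\<dots> = (\<Sum>l\<in>?B. f l v *s w l)"
      using fv r_less by (intro sum.mono_neutral_right) auto
    finally have v_expand: "v = (\<Sum>l\<in>?B. f l v *s w l)" .
    have "y = (\<Sum>z\<in>?A \<times> ?B. fscale (\<phi> (w (fst z)) * f (snd z) v) (Y z))"
    proof
      fix z
      show "y z = (\<Sum>z\<in>?A \<times> ?B. fscale (\<phi> (w (fst z)) * f (snd z) v) (Y z)) z"
      proof (cases "z \<in> V")
        case True
        have "coord (snd z) v = (\<Sum>l\<in>?B. f l v * coord (snd z) (w l))"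
          using True snd_V[OF True] r_less
          by (subst v_expand, intro linear_functional_sum linear_coord) simp
        then have "y z = (\<Sum>m\<in>?A. f m (e (fst z)) * \<phi> (w m)) * (\<Sum>l\<in>?B. f l v * coord (snd z) (w l))"
          using True by (simp add: y outer_def \<phi>_expand[of "e (fst z)"])
        also have "\<dots> = (\<Sum>m\<in>?A. \<Sum>l\<in>?B. (\<phi> (w m) * f l v) * (f m (e (fst z)) * coord (snd z) (w l)))"
          unfolding sum_product by (intro sum.cong refl) (simp add: mult_ac)
        also have "\<dots> = (\<Sum>x\<in>?A \<times> ?B. (\<phi> (w (fst x)) * f (snd x) v) * Y x z)"
          unfolding sum.cartesian_product using True
          by (intro sum.cong refl) (simp add: Y_def outer_def split: prod.split)
        finally show ?thesis by (simp add: sum_fun_apply)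
      next
        case False
        then show ?thesis by (simp add: sum_fun_apply y Y_def outer_def)
      qed
    qed
    also have "\<dots> \<in> fun_space.span (Y ` J)"
      by (rule fun_space.span_sum, rule fun_space.span_scale, rule fun_space.span_base, rule imageI)
        (use i in \<open>auto simp: J_def\<close>)
    finally show "y \<in> fun_space.span (Y ` J)" .
  qed
  then have "fun_space.span (conormal P a) = fun_space.span (Y ` J)"
    using YJ fun_space.span_mono fun_space.span_minimal fun_space.subspace_span
    by (intro subset_antisym) blast+
  then have "fun_space.dim (fun_space.span (conormal P a)) = card J"
    using fun_space.dim_span_eq_card_independent[OF ind(2)] card_image[OF ind(1)] by simp
  \<comment> \<open>The staircase is counted by rows. Row \<open>l\<close> meets the rectangles of
    the active \<open>i \<le> r - l\<close>; as the excess never decreases and is inherited through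
    inactive steps, the row has length \<open>a (r - l) - (r - l)\<close>.\<close>
  also have "\<dots> = card (SIGMA l:{..r}. {d - (a (r - l) - (r - l))..<d})"
  proof (rule bij_betw_same_card, rule bij_betwI[of "\<lambda>(m, l). (l, m)" _ _ "\<lambda>(l, m). (m, l)"])
    show "(\<lambda>(m, l). (l, m)) \<in> J \<rightarrow> (SIGMA l:{..r}. {d - (a (r - l) - (r - l))..<d})"
    proof (rule Pi_I)
      fix z assume "z \<in> J"
      then obtain m l i where z: "z = (m, l)"
        and i: "active r a i" "l < r + 1 - i" "d - (a i - i) \<le> m" "m < d" by (auto simp: J_def)
      have "a i + (r - l - i) \<le> a (r - l)" using i(2) by (intro strict_mono_on_add_le[OF a(1)]) auto
      then have "d - (a (r - l) - (r - l)) \<le> m" using i act(3)[OF i(1)] by linarith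
      then show "(case z of (m, l) \<Rightarrow> (l, m)) \<in> (SIGMA l:{..r}. {d - (a (r - l) - (r - l))..<d})"
        unfolding z prod.case using i(2,4) by (intro SigmaI) auto
    qed
    show "(\<lambda>(l, m). (m, l)) \<in> (SIGMA l:{..r}. {d - (a (r - l) - (r - l))..<d}) \<rightarrow> J"
    proof (rule Pi_I)
      fix z assume "z \<in> (SIGMA l:{..r}. {d - (a (r - l) - (r - l))..<d})"
      then obtain l m where z: "z = (l, m)" and lm: "l \<le> r" "d - (a (r - l) - (r - l)) \<le> m" "m < d" by auto
      have "a (r - l) - (r - l) \<noteq> 0" using lm by linarith
      then obtain i where i: "i \<le> r - l" "active r a i" "a i - i = a (r - l) - (r - l)"
        using excess_active[OF a(1), of "r - l"] by auto
      have "l < r + 1 - i" using i(1) lm(1) by linarith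
      moreover have "d - (a i - i) \<le> m" using i(3) lm(2) by simp
      ultimately have "(m, l) \<in> J" unfolding J_def using i(2) lm(3) by blast
      then show "(case z of (l, m) \<Rightarrow> (m, l)) \<in> J" by (simp add: z)
    qed
  qed auto
  also have "\<dots> = (\<Sum>l\<le>r. a (r - l) - (r - l))"
  proof -
    have "a (r - l) \<le> d" for l using index_less[OF P a open_point, of "r - l"] by simp
    then have "d - (d - (a (r - l) - (r - l))) = a (r - l) - (r - l)" for l
      by (metis diff_diff_cancel diff_le_self le_trans)
    moreover have "card (SIGMA l:{..r}. {d - (a (r - l) - (r - l))..<d}) =
        (\<Sum>l\<le>r. card {d - (a (r - l) - (r - l))..<d})"
      by (rule card_SigmaI) simp_all
    ultimately show ?thesis by (simp only: card_atLeastLessThan)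
  qed
  also have "\<dots> = (\<Sum>i\<le>r. a i - i)"
    by (rule sum.reindex_bij_witness[of _ "\<lambda>i. r - i" "\<lambda>i. r - i"]) auto
  finally show ?thesis .
qed

section \<open>Intersection of the conormal spaces\<close>

lemma hyperplane_decompose:
  assumes "subspace W" "subspace A" "W \<subseteq> A" "u \<in> A" "u \<notin> W" "dim A \<le> dim W + 1" "h \<in> A"
  shows "\<exists>k. h - k *s u \<in> W"
proof -
  have sp: "span W = W" using assms(1) by simp
  have "span (insert u W) \<subseteq> A" using assms by (intro span_minimal) auto
  moreover have "dim A \<le> dim (span (insert u W))"
    using dim_insert[of u W] assms(5,6) sp by simp
  ultimately have "span (insert u W) = A"
    by (intro subspace_dim_equal subspace_span assms(2))
  then show ?thesis using span_breakdown_eq[of h u W] assms(7) sp by simp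
qed

definition special_position :: "(nat \<Rightarrow> 'v set) \<Rightarrow> (nat \<Rightarrow> 'v set) \<Rightarrow> nat \<Rightarrow> (nat \<Rightarrow> nat) \<Rightarrow> (nat \<Rightarrow> nat) \<Rightarrow> bool" where
  "special_position P Q t a b \<longleftrightarrow> (\<exists>i. active r a i \<and> t = a i) \<and> (\<exists>i. active r b i \<and> d - t = b i) \<and>
     P t \<inter> Q (d - t) \<subseteq> L \<and> L \<subseteq> {x + y | x y. x \<in> P t \<and> y \<in> Q (d - t)}"

context
  fixes P Q :: "nat \<Rightarrow> 'v set" and t :: nat
  assumes P: "complete_flag scale P" and Q: "complete_flag scale Q"
    and t: "1 \<le> t" "t < d"
    and meet: "\<And>i. i \<le> d \<Longrightarrow> dim (P i \<inter> Q (d - i)) = (if i = t then 1 else 0)"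
begin

lemma meet_zero: "i \<le> d \<Longrightarrow> i \<noteq> t \<Longrightarrow> u \<in> P i \<Longrightarrow> u \<in> Q (d - i) \<Longrightarrow> u = 0"
  using meet[of i] dim_eq_0[of "P i \<inter> Q (d - i)"] by auto

text \<open>Downward induction from P d = 0. By dimension some nonzero \<open>u\<close> lies in
  \<open>P c \<inter> Q (d - Suc c)\<close>, and it spans \<open>P c\<close> modulo
  \<open>P (Suc c)\<close>. Its image lies in \<open>P (Suc c) \<inter> Q (d - Suc c)\<close>, which
  is 0 because \<open>Suc c \<noteq> t\<close>.\<close>

lemma strict_kills_P:
  assumes add: "\<And>u v. g (u + v) = g u + g v" and scale: "\<And>k u. g (k *s u) = k *s g u"
    and strictP: "\<And>c u. c < d \<Longrightarrow> u \<in> P c \<Longrightarrow> g u \<in> P (c + 1)"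
    and strictQ: "\<And>c u. c < d \<Longrightarrow> u \<in> Q c \<Longrightarrow> g u \<in> Q (c + 1)"
    and h: "h \<in> P t"
  shows "g h = 0"
proof -
  have "\<forall>h\<in>P c. g h = 0" if "t \<le> c" "c \<le> d" for c
    using that(2,1)
  proof (induction c rule: inc_induct)
    case base
    have "dim (P d) = 0" using flagD(2)[OF P, of d] by simp
    then have "P d \<subseteq> {0}" using dim_eq_0 by blast
    moreover have "g 0 = 0" using scale[of 0 0] by simp
    ultimately show ?case by auto
  next
    case (step c)
    have cd: "t \<le> c" "c < d" using step.hyps step.prems by auto
    have IH: "g v = 0" if "v \<in> P (Suc c)" for v using step.IH that cd(1) by auto
    let ?A = "P c" and ?B = "Q (d - Suc c)"
    have sA: "subspace ?A" and sB: "subspace ?B" and sC: "subspace (P (Suc c))"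
      using flagD(1)[OF P] flagD(1)[OF Q] cd by auto
    have "dim {x + y | x y. x \<in> ?A \<and> y \<in> ?B} \<le> d" unfolding d_def by (intro dim_subset) simp
    moreover have "dim ?A + dim ?B = d + 1" using flagD(2)[OF P, of c] flagD(2)[OF Q, of "d - Suc c"] cd by simp
    ultimately have "dim (?A \<inter> ?B) \<noteq> 0" using dim_sums_Int[OF sA sB] by linarith
    then have "\<not> ?A \<inter> ?B \<subseteq> {0}" unfolding dim_eq_0 .
    then obtain u where u: "u \<in> ?A" "u \<in> ?B" "u \<noteq> 0" by blast
    have c: "Suc c \<le> d" "Suc c \<noteq> t" using cd by auto
    have uC: "u \<notin> P (Suc c)"
    proof
      assume "u \<in> P (Suc c)"
      from meet_zero[OF c this] u(2,3) show False by simp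
    qed
    have gu: "g u = 0"
    proof (rule meet_zero[OF c])
      show "g u \<in> P (Suc c)" using strictP[of c u] u(1) cd by simp
      have "g u \<in> Q (d - Suc c + 1)" using strictQ[of "d - Suc c" u] u(2) cd by simp
      moreover have "d - Suc c < d" using cd by linarith
      ultimately show "g u \<in> Q (d - Suc c)" using flagD(3)[OF Q, of "d - Suc c"] by auto
    qed
    show ?case
    proof
      fix h assume h: "h \<in> P c"
      have "P (Suc c) \<subseteq> P c" using flagD(3)[OF P] cd by simp
      moreover have "dim (P c) \<le> dim (P (Suc c)) + 1"
        using flagD(2)[OF P, of c] flagD(2)[OF P, of "Suc c"] cd by simp
      ultimately obtain k where k: "h - k *s u \<in> P (Suc c)"
        using hyperplane_decompose[OF sC sA _ u(1) uC _ h] by blast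
      have "g h = g (h - k *s u) + k *s g u"
        using add[of "h - k *s u" "k *s u"] scale[of k u] by simp
      moreover have "g (h - k *s u) = 0" using IH[OF k] by simp
      ultimately show "g h = 0" using gu by simp
    qed
  qed
  from this[of t] show ?thesis using t h by simp
qed

text \<open>The dimensions add up to d + 1, and the intersection has dimension at most 1: it meets
  the hyperplane Q (d - t + 1) of Q (d - t) only in 0.\<close>

lemma sum_UNIV_P: "\<exists>p q. h = p + q \<and> p \<in> P (t - 1) \<and> q \<in> Q (d - t)"
proof -
  let ?A = "P (t - 1)" and ?B = "Q (d - t)" and ?C = "Q (d - (t - 1))"
  have sA: "subspace ?A" and sB: "subspace ?B" and sC: "subspace ?C"
    using flagD(1)[OF P] flagD(1)[OF Q] t by auto
  have CB: "?C \<subseteq> ?B" using t by (intro flag_antimono[OF Q]) auto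
  have sub: "{x + y | x y. x \<in> ?A \<inter> ?B \<and> y \<in> ?C} \<subseteq> ?B"
    using CB subspace_add[OF sB] by blast
  have "?A \<inter> ?B \<inter> ?C \<subseteq> {0}" using meet_zero[of "t - 1"] t by auto
  then have "dim (?A \<inter> ?B \<inter> ?C) = 0" using dim_eq_0 by blast
  then have "dim (?A \<inter> ?B) + dim ?C \<le> dim ?B"
    using dim_sums_Int[OF subspace_inter[OF sA sB] sC] dim_subset[OF sub] by linarith
  then have "dim (?A \<inter> ?B) \<le> 1"
    using flagD(2)[OF Q, of "d - t"] flagD(2)[OF Q, of "d - (t - 1)"] t by simp
  then have "d \<le> dim {x + y | x y. x \<in> ?A \<and> y \<in> ?B}"
    using dim_sums_Int[OF sA sB] flagD(2)[OF P, of "t - 1"] flagD(2)[OF Q, of "d - t"] t by simp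
  then have "{x + y | x y. x \<in> ?A \<and> y \<in> ?B} = UNIV"
    by (intro subspace_dim_equal subspace_sums sA sB subspace_UNIV) (simp_all only: subset_UNIV flip: d_def)
  then have "h \<in> {x + y | x y. x \<in> ?A \<and> y \<in> ?B}" by simp
  then show ?thesis by blast
qed

lemma dim_sum_PQ: "dim {x + y | x y. x \<in> P t \<and> y \<in> Q (d - t)} + 1 = d"
  using dim_sums_Int[OF flagD(1)[OF P, of t] flagD(1)[OF Q, of "d - t"]] meet[of t]
    flagD(2)[OF P, of t] flagD(2)[OF Q, of "d - t"] t by simp

end

context
  fixes P Q :: "nat \<Rightarrow> 'v set" and t :: nat
  assumes P: "complete_flag scale P" and Q: "complete_flag scale Q"
    and t: "1 \<le> t" "t < d"
    and meet: "\<And>i. i \<le> d \<Longrightarrow> dim (P i \<inter> Q (d - i)) = (if i = t then 1 else 0)"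
begin

text \<open>The hypotheses are symmetric under exchanging the flags and replacing \<open>t\<close>
  by \<open>d - t\<close>. A second context with the same hypotheses makes the lemmas of the first
  one available for both orders of the flags.\<close>

lemma meet_swap: "i \<le> d \<Longrightarrow> dim (Q i \<inter> P (d - i)) = (if i = d - t then 1 else 0)"
  using meet[of "d - i"] t by (auto simp: Int_commute)

lemmas strict_kills_Q = strict_kills_P[OF Q P _ _ meet_swap]
lemmas sum_UNIV_Q = sum_UNIV_P[OF Q P _ _ meet_swap]

text \<open>\<open>g\<close> kills P t and Q (d - t). Writing \<open>h\<close> modulo Q (d - t) as
  an element of P (t - 1) puts the value into P t, and symmetrically into Q (d - t). If
  \<open>g\<close> maps P (t - 1) even into P (t + 1), the value lies in P (t + 1) \<inter> Q (d - t
  - 1) = 0; likewise for Q.\<close>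

lemma strict_image:
  assumes add: "\<And>u v. g (u + v) = g u + g v" and scale: "\<And>k u. g (k *s u) = k *s g u"
    and strictP: "\<And>c u. c < d \<Longrightarrow> u \<in> P c \<Longrightarrow> g u \<in> P (c + 1)"
    and strictQ: "\<And>c u. c < d \<Longrightarrow> u \<in> Q c \<Longrightarrow> g u \<in> Q (c + 1)"
  shows "g h \<in> P t \<inter> Q (d - t)" and "u \<in> {x + y | x y. x \<in> P t \<and> y \<in> Q (d - t)} \<Longrightarrow> g u = 0"
    and "(\<And>u. u \<in> P (t - 1) \<Longrightarrow> g u \<in> P (t + 1)) \<Longrightarrow> g h = 0"
    and "(\<And>u. u \<in> Q (d - t - 1) \<Longrightarrow> g u \<in> Q (d - t + 1)) \<Longrightarrow> g h = 0"
proof -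
  have killP: "g u = 0" if "u \<in> P t" for u
    by (rule strict_kills_P[OF P Q t meet add scale strictP strictQ that])
  have killQ: "g u = 0" if "u \<in> Q (d - t)" for u
    by (rule strict_kills_Q[OF _ _ _ add scale strictQ strictP that]) (use t in auto)
  obtain p q where pq: "h = p + q" "p \<in> P (t - 1)" "q \<in> Q (d - t)"
    using sum_UNIV_P[OF P Q t meet] by blast
  have ghp: "g h = g p" using pq add killQ by simp
  obtain q' p' where qp: "h = q' + p'" "q' \<in> Q (d - t - 1)" "p' \<in> P t"
  proof -
    have "1 \<le> d - t" "d - t < d" "d - (d - t) = t" using t by auto
    then show thesis using sum_UNIV_Q[of h] that by metis
  qed
  have ghq: "g h = g q'" using qp add killP by simp
  have inP: "g h \<in> P t" using strictP[of "t - 1" p] pq(2) t unfolding ghp by simp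
  have inQ: "g h \<in> Q (d - t)" using strictQ[of "d - t - 1" q'] qp(2) t unfolding ghq by (simp add: Suc_diff_Suc)
  show "g h \<in> P t \<inter> Q (d - t)" using inP inQ by simp
  show "g u = 0" if "u \<in> {x + y | x y. x \<in> P t \<and> y \<in> Q (d - t)}"
    using that add killP killQ by auto
  show "g h = 0" if "\<And>u. u \<in> P (t - 1) \<Longrightarrow> g u \<in> P (t + 1)"
  proof (rule meet_zero[OF P Q t meet])
    show "g h \<in> P (t + 1)" using that[OF pq(2)] ghp by simp
    have "Q (d - t) \<subseteq> Q (d - (t + 1))" by (rule flag_antimono[OF Q]) auto
    then show "g h \<in> Q (d - (t + 1))" using inQ by blast
  qed (use t in auto)
  show "g h = 0" if "\<And>u. u \<in> Q (d - t - 1) \<Longrightarrow> g u \<in> Q (d - t + 1)"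
  proof (rule meet_zero[OF P Q t meet, of "t - 1"])
    have "P t \<subseteq> P (t - 1)" using t by (intro flag_antimono[OF P]) auto
    then show "g h \<in> P (t - 1)" using inP by blast
    show "g h \<in> Q (d - (t - 1))" using that[OF qp(2)] ghq t by (simp add: Suc_diff_le)
  qed (use t in auto)
qed

context
  fixes a b :: "nat \<Rightarrow> nat"
  assumes a: "\<And>i. active r a i \<Longrightarrow> a i \<le> d" and b: "\<And>i. active r b i \<Longrightarrow> b i \<le> d"
begin

text \<open>Strictness is \<open>endo_step\<close> with \<open>c' = c + 1\<close>. If no active
  entry equals \<open>t\<close>, the step from \<open>t - 1\<close> to \<open>t + 1\<close> is
  allowed as well, and this forces the map to vanish.\<close>

lemma endo_conormal_Int:
  assumes y: "y \<in> fun_space.span (conormal P a) \<inter> fun_space.span (conormal Q b)"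
  shows "endo y h \<in> P t \<inter> Q (d - t)"
    and "u \<in> {x + y | x y. x \<in> P t \<and> y \<in> Q (d - t)} \<Longrightarrow> endo y u = 0"
    and "\<forall>i. active r a i \<longrightarrow> a i \<noteq> t \<Longrightarrow> endo y h = 0"
    and "\<forall>i. active r b i \<longrightarrow> b i \<noteq> d - t \<Longrightarrow> endo y h = 0"
proof -
  have strictP: "endo y u \<in> P (c + 1)" if "c < d" "u \<in> P c" for c u
    using y that by (intro endo_step[OF P a, where c = c]) auto
  have strictQ: "endo y u \<in> Q (c + 1)" if "c < d" "u \<in> Q c" for c u
    using y that by (intro endo_step[OF Q b, where c = c]) auto
  note image = strict_image[where g = "endo y", OF endo_add endo_scale strictP strictQ]
  show "endo y h \<in> P t \<inter> Q (d - t)" by (rule image(1))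
  show "endo y u = 0" if "u \<in> {x + y | x y. x \<in> P t \<and> y \<in> Q (d - t)}" by (rule image(2)[OF _ _ _ _ that])
  show "endo y h = 0" if *: "\<forall>i. active r a i \<longrightarrow> a i \<noteq> t"
  proof (rule image(3))
    show "endo y u \<in> P (t + 1)" if "u \<in> P (t - 1)" for u
    proof (rule endo_step[OF P a _ _ _ _ that])
      show "a i \<le> t - 1 \<or> t + 1 \<le> a i" if "active r a i" for i
      proof -
        have "a i \<noteq> t" using * that by blast
        then show ?thesis by linarith
      qed
    qed (use y t in auto)
  qed
  show "endo y h = 0" if *: "\<forall>i. active r b i \<longrightarrow> b i \<noteq> d - t"
  proof (rule image(4))
    show "endo y u \<in> Q (d - t + 1)" if "u \<in> Q (d - t - 1)" for u
    proof (rule endo_step[OF Q b _ _ _ _ that])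
      show "b i \<le> d - t - 1 \<or> d - t + 1 \<le> b i" if "active r b i" for i
      proof -
        have "b i \<noteq> d - t" using * that by blast
        then show ?thesis by linarith
      qed
    qed (use y t in auto)
  qed
qed

lemma line: "\<exists>l. l \<noteq> 0 \<and> P t \<inter> Q (d - t) = span {l}"
proof -
  have "dim (P t \<inter> Q (d - t)) = 1" using meet[of t] t by simp
  then have "\<not> P t \<inter> Q (d - t) \<subseteq> {0}" using dim_eq_0[of "P t \<inter> Q (d - t)"] by simp
  then obtain l where l: "l \<in> P t \<inter> Q (d - t)" "l \<noteq> 0" by blast
  have "span {l} = P t \<inter> Q (d - t)"
  proof (rule subspace_dim_equal)
    show "subspace (P t \<inter> Q (d - t))" using flagD(1)[OF P] flagD(1)[OF Q] t by (intro subspace_inter) auto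
    then show "span {l} \<subseteq> P t \<inter> Q (d - t)" using l(1) by (intro span_minimal) simp
    show "dim (P t \<inter> Q (d - t)) \<le> dim (span {l})" using meet[of t] t l(2) by simp
  qed simp
  then show ?thesis using l(2) by blast
qed

lemma sum_PQ: "subspace {x + y | x y. x \<in> P t \<and> y \<in> Q (d - t)}"
  using flagD(1)[OF P] flagD(1)[OF Q] t by (intro subspace_sums) auto

lemma decompose_PQ:
  assumes "h0 \<notin> {x + y | x y. x \<in> P t \<and> y \<in> Q (d - t)}"
  shows "\<exists>k. h - k *s h0 \<in> {x + y | x y. x \<in> P t \<and> y \<in> Q (d - t)}"
proof (rule hyperplane_decompose[OF sum_PQ subspace_UNIV _ _ assms])
  show "dim UNIV \<le> dim {x + y | x y. x \<in> P t \<and> y \<in> Q (d - t)} + 1"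
    using dim_sum_PQ[OF P Q t meet] unfolding d_def by simp
qed simp_all

text \<open>A nonzero value spans the line P t \<inter> Q (d - t) and lies in \<open>L\<close>, so
  the line does. If \<open>L\<close> were not inside the hyperplane P t + Q (d - t), the two
  together would span H, but the map vanishes on both.\<close>

lemma conormal_Int_nonspecial:
  assumes "\<not> special_position P Q t a b" "y \<in> fun_space.span (conormal P a) \<inter> fun_space.span (conormal Q b)"
  shows "y = 0"
proof (rule endo_inj)
  show "y \<in> supported V" using assms(2) conormal_supported by blast
  note E = endo_conormal_Int[OF assms(2)]
  obtain l where l: "l \<noteq> 0" "P t \<inter> Q (d - t) = span {l}" using line by blast
  show "endo y h = 0" for h
  proof (rule ccontr)
    assume ne: "endo y h \<noteq> 0"
    have ex_a: "\<exists>i. active r a i \<and> t = a i"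
    proof (rule ccontr)
      assume "\<not> ?thesis"
      then have "\<forall>i. active r a i \<longrightarrow> a i \<noteq> t" by blast
      then show False using E(3) ne by blast
    qed
    have ex_b: "\<exists>i. active r b i \<and> d - t = b i"
    proof (rule ccontr)
      assume "\<not> ?thesis"
      then have "\<forall>i. active r b i \<longrightarrow> b i \<noteq> d - t" by metis
      then show False using E(4) ne by blast
    qed
    obtain k where k: "endo y h = k *s l" using E(1)[of h] l(2) by (auto simp: span_singleton)
    then have "l = inverse k *s endo y h" using ne by auto
    then have "l \<in> L" using endo_in_L subspace_scale[OF subspace_L] by metis
    then have in_L: "P t \<inter> Q (d - t) \<subseteq> L"
      unfolding l(2) by (intro span_minimal subspace_L) simp
    have "L \<subseteq> {x + y | x y. x \<in> P t \<and> y \<in> Q (d - t)}"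
    proof (rule ccontr)
      assume "\<not> ?thesis"
      then obtain u where u: "u \<in> L" "u \<notin> {x + y | x y. x \<in> P t \<and> y \<in> Q (d - t)}" by blast
      obtain c where c: "h - c *s u \<in> {x + y | x y. x \<in> P t \<and> y \<in> Q (d - t)}"
        using decompose_PQ[OF u(2)] by blast
      have "endo y h = endo y (h - c *s u) + c *s endo y u"
        using endo_add[of y "h - c *s u" "c *s u"] endo_scale[of y c u] by simp
      then show False using ne E(2)[OF c] endo_zero_on_L[OF u(1)] by simp
    qed
    then show False using assms(1) ex_a ex_b in_L unfolding special_position_def by blast
  qed
qed

text \<open>In special position the generator is h \<mapsto> \<open>\<phi> h *s l\<close>, where
  \<open>\<phi>\<close> has kernel P t + Q (d - t) and \<open>l\<close> spans P t \<inter> Q (d -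
  t). The special conditions are what makes it an element of both conormal spaces.\<close>

lemma dim_conormal_Int:
  "fun_space.dim (fun_space.span (conormal P a) \<inter> fun_space.span (conormal Q b)) = (if special_position P Q t a b then 1 else 0)"
    (is "fun_space.dim ?I = _")
proof (cases "special_position P Q t a b")
  case False
  then have "?I = fun_space.span {}"
    using conormal_Int_nonspecial fun_space.span_zero by (auto simp: fun_space.span_zero)
  then show ?thesis
    using False fun_space.dim_span_eq_card_independent[OF fun_space.independent_empty] by simp
next
  case True
  let ?W = "{x + y | x y. x \<in> P t \<and> y \<in> Q (d - t)}"
  obtain l where l: "l \<noteq> 0" "P t \<inter> Q (d - t) = span {l}" using line by blast
  have lPQ: "l \<in> P t" "l \<in> Q (d - t)" using l(2) span_base[of l "{l}"] by auto
  have lL: "l \<in> L" using True lPQ unfolding special_position_def by blast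
  have "?W \<noteq> UNIV" using dim_sum_PQ[OF P Q t meet] unfolding d_def by auto
  then obtain h0 where h0: "h0 \<notin> ?W" by blast
  obtain \<phi> where \<phi>: "Vector_Spaces.linear scale (*) \<phi>" "\<And>x. x \<in> ?W \<Longrightarrow> \<phi> x = 0" "\<phi> h0 = 1"
    using separating_functional[OF sum_PQ h0] by blast
  have WP: "u \<in> ?W" if "u \<in> P t" for u
    using that subspace_0[OF flagD(1)[OF Q, of "d - t"]] by (intro CollectI exI[of _ u] exI[of _ 0]) simp
  have WQ: "u \<in> ?W" if "u \<in> Q (d - t)" for u
    using that t subspace_0[OF flagD(1)[OF P, of t]] by (intro CollectI exI[of _ 0] exI[of _ u]) simp
  have LW: "L \<subseteq> ?W" using True unfolding special_position_def by simp
  have ann: "\<phi> \<in> annihilator scale L" "\<phi> \<in> annihilator scale (P t)" "\<phi> \<in> annihilator scale (Q (d - t))"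
    using \<phi>(1) \<phi>(2)[OF WP] \<phi>(2)[OF WQ] \<phi>(2)[OF subsetD[OF LW]] unfolding annihilator_def by simp_all
  let ?y0 = "outer \<phi> l"
  have "?y0 \<in> conormal P a" "?y0 \<in> conormal Q b"
  proof -
    obtain i j where "active r a i" "t = a i" "active r b j" "d - t = b j"
      using True unfolding special_position_def by blast
    then show "?y0 \<in> conormal P a" "?y0 \<in> conormal Q b"
      using ann lPQ lL unfolding conormal_def by (metis (mono_tags, lifting) IntI mem_Collect_eq)+
  qed
  then have y0: "?y0 \<in> ?I" by (simp add: fun_space.span_base)
  have endo_y0: "endo ?y0 h = \<phi> h *s l" for h by (rule endo_outer[OF ann(1) lL])
  have "?y0 \<noteq> 0"
  proof
    assume "?y0 = 0"
    then have "endo ?y0 h0 = 0" by (simp add: endo_def)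
    then show False using endo_y0 \<phi>(3) l(1) by simp
  qed
  then have ind: "fun_space.independent {?y0}" by simp
  have "?I = fun_space.span {?y0}"
  proof (intro subset_antisym)
    show "fun_space.span {?y0} \<subseteq> ?I"
      using y0 by (intro fun_space.span_minimal fun_space.subspace_inter fun_space.subspace_span) simp
    show "?I \<subseteq> fun_space.span {?y0}"
    proof
      fix y assume y: "y \<in> ?I"
      note E = endo_conormal_Int[OF y]
      obtain k where k: "endo y h0 = k *s l" using E(1)[of h0] l(2) by (auto simp: span_singleton)
      \<comment> \<open>\<open>y\<close> and \<open>k\<close> times \<open>?y0\<close> agree at
        \<open>h0\<close> and both vanish on the hyperplane \<open>?W\<close>; together these span
        H.\<close>
      have "y + fscale (- k) ?y0 = 0"
      proof (rule endo_inj)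
        show "y + fscale (- k) ?y0 \<in> supported V"
          using y y0 conormal_supported[of P a]
          by (intro fun_space.subspace_add fun_space.subspace_scale subspace_supported) auto
        fix h
        obtain c where c: "h - c *s h0 \<in> ?W" using decompose_PQ[OF h0] by blast
        have hc: "h = (h - c *s h0) + c *s h0" by simp
        have "endo y h = c *s k *s l"
          using E(2)[OF c] k endo_add[of y "h - c *s h0" "c *s h0"] endo_scale[of y c h0] by simp
        moreover have "\<phi> h = c"
        proof -
          have "\<phi> h = \<phi> (h - c *s h0) + c * \<phi> h0"
            using \<phi>(1) hc unfolding linear_functional_iff by metis
          then show ?thesis using \<phi>(2)[OF c] \<phi>(3) by simp
        qed
        ultimately show "endo (y + fscale (- k) ?y0) h = 0"
          unfolding endo_add_left endo_scale_left endo_y0 by (simp add: mult.commute)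
      qed
      then have "y = fscale k ?y0" by (simp add: fun_eq_iff)
      then show "y \<in> fun_space.span {?y0}"
        by (simp only:) (rule fun_space.span_scale, rule fun_space.span_base, simp)
    qed
  qed
  then show ?thesis using True fun_space.dim_span_eq_card_independent[OF ind] by simp
qed

end

end

text \<open>The tangent space of the intersection is the orthogonal complement of the sum of the
  conormal spaces, whose dimension is given by the two dimensions and that of the intersection. The
  additive form avoids truncated subtraction.\<close>

lemma tangent_dim_conormal:
  assumes P: "complete_flag scale P" "strict_mono_on {..r} a" "a r < d" "L \<in> schubert_open_points scale r P a"
    and Q: "complete_flag scale Q" "strict_mono_on {..r} b" "b r < d" "L \<in> schubert_open_points scale r Q b"
  shows "schubert_intersection_tangent_dim scale r e P a Q b + (\<Sum>i\<le>r. a i - i) + (\<Sum>i\<le>r. b i - i) =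
    (r + 1) * (d - r - 1) + fun_space.dim (fun_space.span (conormal P a) \<inter> fun_space.span (conormal Q b))"
proof -
  let ?A = "fun_space.span (conormal P a)" and ?B = "fun_space.span (conormal Q b)"
  let ?U = "{x + y | x y. x \<in> ?A \<and> y \<in> ?B}"
  let ?G = "\<lambda>P a. \<Union>i\<le>r. chart_minors scale r e (P (a i)) (i + 1)"
  have perp: "(\<forall>f\<in>?G P a \<union> ?G Q b. lin_coeff V x f = 0) \<longleftrightarrow> (\<forall>y\<in>?U. pairing V x y = 0)" for x
  proof -
    have "(\<forall>f\<in>?G P a \<union> ?G Q b. lin_coeff V x f = 0) \<longleftrightarrow>
        (\<forall>y\<in>conormal P a \<union> conormal Q b. pairing V x y = 0)"
      unfolding ball_Un lin_coeff_minors_iff[OF P] lin_coeff_minors_iff[OF Q] ..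
    also have "\<dots> \<longleftrightarrow> (\<forall>y\<in>fun_space.span (conormal P a \<union> conormal Q b). pairing V x y = 0)"
    proof
      assume *: "\<forall>y\<in>conormal P a \<union> conormal Q b. pairing V x y = 0"
      show "\<forall>y\<in>fun_space.span (conormal P a \<union> conormal Q b). pairing V x y = 0"
        using fun_space.functional_zero_on_span[OF linear_pairing] * by blast
    next
      assume "\<forall>y\<in>fun_space.span (conormal P a \<union> conormal Q b). pairing V x y = 0"
      then show "\<forall>y\<in>conormal P a \<union> conormal Q b. pairing V x y = 0"
        using fun_space.span_superset by blast
    qed
    finally show ?thesis unfolding fun_space.span_Un .
  qed
  have "schubert_intersection_tangent_dim scale r e P a Q b =
      fun_space.dim {x \<in> supported V. \<forall>f\<in>?G P a \<union> ?G Q b. lin_coeff V x f = 0}"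
    unfolding schubert_intersection_tangent_dim_def schubert_ideal_def d_def[symmetric]
    by (rule tangent_dim_sum_ideals[OF finite_V chart_minors_origin_ideal[OF P] chart_minors_origin_ideal[OF Q]])
  also have "\<dots> = fun_space.dim {x \<in> supported V. \<forall>y\<in>?U. pairing V x y = 0}"
    unfolding perp ..
  finally have T: "schubert_intersection_tangent_dim scale r e P a Q b = \<dots>" .
  have sub: "?A \<subseteq> fun_space.span (unit_fun ` V)" "?B \<subseteq> fun_space.span (unit_fun ` V)"
    unfolding unit_funs(3)[OF finite_V] by (rule conormal_supported)+
  have "?U \<subseteq> supported V"
    using conormal_supported fun_space.subspace_add[OF subspace_supported] by blast
  then have "fun_space.dim {x \<in> supported V. \<forall>y\<in>?U. pairing V x y = 0} + fun_space.dim ?U = card V"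
    by (intro dim_orthogonal finite_V fun_space.subspace_sums fun_space.subspace_span)
  moreover have "fun_space.dim ?U + fun_space.dim (?A \<inter> ?B) = fun_space.dim ?A + fun_space.dim ?B"
    using finite_V by (intro fun_space.dim_sums_Int_finite_span[OF _ _ sub]) auto
  ultimately show ?thesis
    unfolding T dim_conormal[OF P] dim_conormal[OF Q] card_V by linarith
qed

end

theorem corollary2p12:
  fixes scale :: "'k::alg_closed_field \<Rightarrow> 'v::ab_group_add \<Rightarrow> 'v"
    and Basis :: "'v set"
    and d r t t' :: nat
    and P Q :: "nat \<Rightarrow> 'v set"
    and a b :: "nat \<Rightarrow> nat"
    and \<Lambda> :: "'v set"
    and e :: "nat \<Rightarrow> 'v"
    and \<rho> :: int
  assumes "finite_dimensional_vector_space scale Basis"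
    and "d = vector_space.dim scale (UNIV :: 'v set)"
    and "complete_flag scale P" and "complete_flag scale Q"
    and "strict_mono_on {..r} a" and "a r < d"
    and "strict_mono_on {..r} b" and "b r < d"
    and "\<rho> = 1 + (int r + 1) * (int d - int r - 1)
               - (\<Sum>i\<le>r. int (a i) - int i) - (\<Sum>i\<le>r. int (b i) - int i)"
    and "\<Lambda> \<in> schubert_open_points scale r P a \<inter> schubert_open_points scale r Q b"
    and "almost_transverse scale P Q"
    and "t + t' = d" and "vector_space.dim scale (P t \<inter> Q t') = 1"
    and "adapted_frame scale r \<Lambda> e"
  defines "special \<equiv>
      (\<exists>i. active r a i \<and> t = a i) \<and> (\<exists>i'. active r b i' \<and> t' = b i') \<and>
      P t \<inter> Q t' \<subseteq> \<Lambda> \<and> \<Lambda> \<subseteq> {x + y | x y. x \<in> P t \<and> y \<in> Q t'}"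
  shows "(special \<longrightarrow> int (schubert_intersection_tangent_dim scale r e P a Q b) = \<rho>) \<and>
         (\<not> special \<longrightarrow> int (schubert_intersection_tangent_dim scale r e P a Q b) = \<rho> - 1)"
proof -
  interpret finite_dimensional_vector_space scale Basis by fact
  have open_points: "\<Lambda> \<in> schubert_open_points scale r P a" "\<Lambda> \<in> schubert_open_points scale r Q b"
    using assms(10) by auto
  have ra: "i \<le> a i" and rb: "i \<le> b i" if "i \<le> r" for i
    using strict_mono_on_le assms(5,7) that by blast+
  \<comment> \<open>The chart requires \<open>r < d\<close>; strict increase gives
    \<open>r \<le> a r\<close>, and \<open>a r < d\<close>.\<close>
  have rd: "r < d" using ra[of r] assms(6) by simp
  interpret adapted_chart scale Basis d r \<Lambda> e
    by unfold_locales (use assms(2,14) rd in auto)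
  obtain t0 where t0: "1 \<le> t0" "t0 \<le> d - 1"
    "\<And>i. i \<le> d \<Longrightarrow> dim (P i \<inter> Q (d - i)) = (if i = t0 then 1 else 0)"
    using assms(11) unfolding almost_transverse_def Let_def assms(2)[symmetric] by blast
  have t': "t' = d - t" and td: "t \<le> d" using assms(12) by auto
  have "t = t0" using t0(3)[OF td] assms(13) unfolding t' by (metis zero_neq_one)
  then have t: "1 \<le> t" "t < d" and meet: "\<And>i. i \<le> d \<Longrightarrow> dim (P i \<inter> Q (d - i)) = (if i = t then 1 else 0)"
    using t0 by auto
  note PA = assms(3,5,6) open_points(1) and QB = assms(4,7,8) open_points(2)
  have act: "active r a i \<Longrightarrow> a i \<le> d" "active r b i \<Longrightarrow> b i \<le> d" for i
    using index_less[OF PA, of i] index_less[OF QB, of i] by (simp_all add: active_def)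
  \<comment> \<open>\<open>N\<close> is the dimension of the chart, \<open>A\<close> and
    \<open>B\<close> are the two codimensions, and \<open>D\<close> is the dimension of the
    intersection of the conormal spaces.\<close>
  have arith: "(s \<longrightarrow> int T = 1 + z - x - y) \<and> (\<not> s \<longrightarrow> int T = 1 + z - x - y - 1)"
    if "T + A + B = N + D" "D = (if s then 1 else 0)" "int A = x" "int B = y" "int N = z"
    for T A B N D :: nat and x y z :: int and s
    using that by auto
  have dim_Int: "fun_space.dim (fun_space.span (conormal P a) \<inter> fun_space.span (conormal Q b)) =
      (if special_position P Q t a b then 1 else 0)"
    by (rule dim_conormal_Int[where a = a and b = b, OF assms(3,4) t meet act])
  show ?thesis
    unfolding assms(9)
  proof (rule arith[OF tangent_dim_conormal[OF PA QB]])
    show "fun_space.dim (fun_space.span (conormal P a) \<inter> fun_space.span (conormal Q b)) =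
        (if special then 1 else 0)"
      using dim_Int unfolding special_def t' special_position_def .
    \<comment> \<open>The subtraction of natural numbers is exact because \<open>i \<le> a i\<close>
      and \<open>i \<le> b i\<close>.\<close>
    show "int (\<Sum>i\<le>r. a i - i) = (\<Sum>i\<le>r. int (a i) - int i)"
      "int (\<Sum>i\<le>r. b i - i) = (\<Sum>i\<le>r. int (b i) - int i)"
      unfolding of_nat_sum by (intro sum.cong refl; use ra rb in \<open>simp add: of_nat_diff\<close>)+
    have "int (d - r - 1) = int d - int r - 1" using rd by linarith
    then show "int ((r + 1) * (d - r - 1)) = (int r + 1) * (int d - int r - 1)"
      by (simp only: of_nat_mult of_nat_add of_nat_1)
  qed
qed

end
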